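(* Let $f_0\in L^1_+(0,\infty)$ be a probability density and consider, for each even positive integer $n$, the $n$-particle system with law $\mathbb{P}_n$ started from $(a_1,\dots,a_n)$, with empirical measure $F^n(t)$ (all defined in the context). Let $\mathbb{Q}$ denote the product measure $\prod_n\mathbb{P}_n$ over even integers $n\ge2$. Then for every $T>0$, $$\lim_{n\to\infty}\ \sup_{t\in[0,T]} d\left(F^n(t),\rho(t)S_t^*F_0\right)=0\qquad \mathbb{Q}\text{-almost surely},$$ where the limit is over even $n$.
   Context: Particle system. Let $F_0(x)=\int_0^x f_0(y)\,dy$ and, for an even positive integer $n$, let $a_k=F_0^{-1}\left(\frac{2k-1}{2n}\right)$, $1\le k\le n$ ($F_0^{-1}$ is the generalized inverse; $0<a_1<\dots<a_n$ since $F_0$ is continuous). The system starts at time $0$ with $n$ particles at $a_1,\dots,a_n$. All particles move to the left at unit speed. Each time the left-most particle hits $0$, it is removed together with one other particle chosen uniformly at random (independently of the past) from the remaining particles in $(0,\infty)$; this is repeated until no particles remain. $\mathbb{P}_n$ denotes the law of the process. If the particles present at time $t$ are $x_1(t),\dots,x_m(t)$ (after any removal occurring at time $t$), the empirical measure is $F^n(t)=\frac1n\sum_{i=1}^m\delta_{x_i(t)}$. Notation. $\rho(t)=\int_t^\infty f_0(y)\,dy$. A measure and its distribution function $\mu(x)=\mu([0,x))$ are denoted by the same symbol; in particular $F_0$ also denotes the measure with density $f_0$. For $h\geq 0$, $(S_h\varphi)(x)=\varphi(x-h)\mathbf{1}_{x\ge h}$ and its dual on measures is $(S_h^*\mu)(x)=\mu(x+h)-\mu(h)$,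 i.e. $\langle S_h^*\mu,\varphi\rangle=\langle\mu,S_h\varphi\rangle$, where $\langle\mu,\varphi\rangle=\int\varphi\,d\mu$. For finite positive measures $\mu,\nu$ on $\mathbb{R}_+=[0,\infty)$, $d(\mu,\nu)=\sup_{\|\varphi\|_{BL}\le1}\langle\mu-\nu,\varphi\rangle$, where $\|\varphi\|_{BL}=\sup_x|\varphi(x)|+\sup_{x\ne y}\frac{|\varphi(x)-\varphi(y)|}{|x-y|}$. *)

theory Defs
  imports "HOL-Probability.Probability"
begin

text \<open>
  Measures on $\mathbb{R}_+ = [0,\infty)$ are values of type \<^typ>\<open>real measure\<close> on the Borel
  sets of \<^term>\<open>{0..}\<close>.
\<close>

abbreviation halfline :: "real measure" where
  "halfline \<equiv> restrict_space borel {0..}"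


section \<open>The bounded Lipschitz distance\<close>

text \<open>
  The suprema are taken in \<^typ>\<open>ereal\<close>, so that an unbounded or non-Lipschitz function gets
  norm \<open>\<infinity>\<close>. Only the values of \<open>\<phi>\<close> on the half-line matter.
\<close>

definition bl_norm :: "(real \<Rightarrow> real) \<Rightarrow> ereal" where
  "bl_norm \<phi> = (SUP x\<in>{0..}. ereal \<bar>\<phi> x\<bar>)
     + (SUP (x, y)\<in>{(x, y). 0 \<le> x \<and> 0 \<le> y \<and> x \<noteq> y}. ereal (\<bar>\<phi> x - \<phi> y\<bar> / \<bar>x - y\<bar>))"

definition bl_dist :: "real measure \<Rightarrow> real measure \<Rightarrow> ereal" where
  "bl_dist \<mu> \<nu> = (SUP \<phi>\<in>{\<phi>. bl_norm \<phi> \<le> 1}. ereal (integral\<^sup>L \<mu> \<phi> - integral\<^sup>L \<nu> \<phi>))"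


section \<open>Shifts\<close>

definition shift_fun :: "real \<Rightarrow> (real \<Rightarrow> real) \<Rightarrow> real \<Rightarrow> real" where
  "shift_fun h \<phi> x = (if x \<ge> h then \<phi> (x - h) else 0)"

text \<open>
  For \<open>h \<ge> 0\<close> the dual shift is the push-forward under $x \mapsto x - h$ of the restriction of \<open>\<mu>\<close> to
  $[h,\infty)$; the two lemmas below give the duality and the distribution function.
\<close>

definition shift_measure :: "real \<Rightarrow> real measure \<Rightarrow> real measure" where
  "shift_measure h \<mu> = distr (restrict_space \<mu> {h..}) halfline (\<lambda>x. x - h)"

lemma sets_halfline_iff: "A \<in> sets halfline \<longleftrightarrow> A \<in> sets borel \<and> A \<subseteq> {0..}"
  by (subst sets_restrict_space_iff) auto

lemma measurable_shift:
  assumes "sets \<mu> = sets halfline" "0 \<le> h"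
  shows "(\<lambda>x. x - h) \<in> restrict_space \<mu> {h..} \<rightarrow>\<^sub>M halfline"
proof -
  have "(\<lambda>x. x - h) \<in> restrict_space halfline {h..} \<rightarrow>\<^sub>M halfline"
  proof (rule measurable_restrict_space2)
    show "(\<lambda>x. x - h) \<in> restrict_space halfline {h..} \<rightarrow>\<^sub>M borel"
      by (intro measurable_restrict_space1) simp
  qed (auto simp: space_restrict_space)
  moreover have "sets (restrict_space \<mu> {h..}) = sets (restrict_space halfline {h..})"
    by (simp only: sets_restrict_space assms(1))
  ultimately show ?thesis
    by (subst measurable_cong_sets[OF _ refl]) auto
qed

lemma integral_shift_measure:
  assumes "sets \<mu> = sets halfline" "0 \<le> h" "\<phi> \<in> borel_measurable halfline"
  shows "integral\<^sup>L (shift_measure h \<mu>) \<phi> = integral\<^sup>L \<mu> (shift_fun h \<phi>)"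
proof -
  have sp: "space \<mu> = {0..}"
    using sets_eq_imp_space_eq[OF assms(1)] by (simp add: space_restrict_space)
  have h_sets: "{h..} \<inter> space \<mu> \<in> sets \<mu>"
    unfolding assms(1) sets_halfline_iff sp by auto
  have "integral\<^sup>L (shift_measure h \<mu>) \<phi> = (LINT x|restrict_space \<mu> {h..}. \<phi> (x - h))"
    unfolding shift_measure_def
    by (rule integral_distr[OF measurable_shift[OF assms(1,2)] assms(3)])
  also have "\<dots> = (LINT x:{h..}|\<mu>. \<phi> (x - h))"
    unfolding set_lebesgue_integral_def by (rule integral_restrict_space[OF h_sets])
  also have "\<dots> = integral\<^sup>L \<mu> (shift_fun h \<phi>)"
    unfolding set_lebesgue_integral_def
    by (intro arg_cong[where f = "integral\<^sup>L \<mu>"]) (auto simp: shift_fun_def)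
  finally show ?thesis .
qed

lemma measure_shift_measure:
  assumes "finite_measure \<mu>" "sets \<mu> = sets halfline" "0 \<le> h" "0 \<le> x"
  shows "measure (shift_measure h \<mu>) {0..<x} = measure \<mu> {0..<x + h} - measure \<mu> {0..<h}"
proof -
  interpret finite_measure \<mu> by fact
  have sp: "space \<mu> = {0..}"
    using sets_eq_imp_space_eq[OF assms(2)] by (simp add: space_restrict_space)
  have meas: "{0..<b} \<in> sets \<mu>" for b
    unfolding assms(2) sets_halfline_iff by auto
  have h_sets: "{h..} \<inter> space \<mu> \<in> sets \<mu>"
    unfolding assms(2) sets_halfline_iff sp by auto
  have "measure (shift_measure h \<mu>) {0..<x}
      = measure (restrict_space \<mu> {h..}) ((\<lambda>y. y - h) -` {0..<x} \<inter> space (restrict_space \<mu> {h..}))"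
    unfolding shift_measure_def
    by (rule measure_distr[OF measurable_shift[OF assms(2,3)]]) (auto simp: sets_halfline_iff)
  also have "(\<lambda>y. y - h) -` {0..<x} \<inter> space (restrict_space \<mu> {h..}) = {h..<x + h}"
    using assms(3) by (auto simp: space_restrict_space sp)
  also have "measure (restrict_space \<mu> {h..}) {h..<x + h} = measure \<mu> {h..<x + h}"
    by (rule measure_restrict_space[OF h_sets]) auto
  also have "{h..<x + h} = {0..<x + h} - {0..<h}"
    using assms(3) by auto
  also have "measure \<mu> \<dots> = measure \<mu> {0..<x + h} - measure \<mu> {0..<h}"
    by (rule finite_measure_Diff[OF meas meas]) (use assms(4) in auto)
  finally show ?thesis .
qed


section \<open>The initial distribution\<close>

definition init_measure :: "(real \<Rightarrow> real) \<Rightarrow> real measure" where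
  "init_measure f0 = distr (density (lebesgue_on {0<..}) (\<lambda>y. ennreal (f0 y))) halfline (\<lambda>y. y)"

definition init_cdf :: "(real \<Rightarrow> real) \<Rightarrow> real \<Rightarrow> real" where
  "init_cdf f0 x = (LINT y:{0<..<x}|lebesgue. f0 y)"

lemma measure_init_measure:
  assumes f: "set_integrable lebesgue {0<..} f0"
    and pos: "AE y in lebesgue. 0 < y \<longrightarrow> 0 \<le> f0 y"
  shows "measure (init_measure f0) {0..<x} = init_cdf f0 x"
proof -
  let ?L = "lebesgue_on {0<..} :: real measure"
  have int: "integrable ?L f0"
    using f by (subst integrable_restrict_space) (auto simp: set_integrable_def)
  have posL: "AE y in ?L. 0 \<le> f0 y"
    using pos by (subst AE_restrict_space_iff) auto
  have "(\<lambda>y. y) \<in> ?L \<rightarrow>\<^sub>M halfline"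
  proof (rule measurable_restrict_space2)
    show "(\<lambda>y. y) \<in> ?L \<rightarrow>\<^sub>M borel"
      by (intro measurable_restrict_space1 measurable_completion) simp
  qed (auto simp: space_restrict_space)
  then have m: "(\<lambda>y. y) \<in> density ?L (\<lambda>y. ennreal (f0 y)) \<rightarrow>\<^sub>M halfline"
    by simp
  have S: "{0<..<x} \<in> sets ?L"
    by (subst sets_restrict_space_iff) auto
  have "emeasure (init_measure f0) {0..<x} = emeasure (density ?L (\<lambda>y. ennreal (f0 y))) {0<..<x}"
    unfolding init_measure_def
    by (subst emeasure_distr[OF m]) (auto simp: sets_halfline_iff space_restrict_space intro!: arg_cong[where f="emeasure _"])
  also have "\<dots> = (\<integral>\<^sup>+y. ennreal (f0 y) * indicator {0<..<x} y \<partial>?L)"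
    using int S by (intro emeasure_density) auto
  also have "\<dots> = (\<integral>\<^sup>+y. ennreal (f0 y * indicator {0<..<x} y) \<partial>?L)"
    by (intro nn_integral_cong) (auto simp: indicator_def)
  also have "\<dots> = ennreal (LINT y|?L. f0 y * indicator {0<..<x} y)"
    using posL by (intro nn_integral_eq_integral integrable_real_mult_indicator int S) auto
  also have "(LINT y|?L. f0 y * indicator {0<..<x} y) = init_cdf f0 x"
    unfolding init_cdf_def set_lebesgue_integral_def
    by (subst integral_restrict_space) (auto intro!: Bochner_Integration.integral_cong simp: indicator_def)
  finally have "emeasure (init_measure f0) {0..<x} = ennreal (init_cdf f0 x)" .
  moreover have "0 \<le> init_cdf f0 x"
    unfolding init_cdf_def set_lebesgue_integral_def using pos
    by (intro integral_nonneg_AE) (auto simp: indicator_def elim!: eventually_mono)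
  ultimately show ?thesis
    by (simp add: measure_def)
qed

definition survival :: "(real \<Rightarrow> real) \<Rightarrow> real \<Rightarrow> real" where
  "survival f0 t = (LINT y:{t<..}|lebesgue. f0 y)"

text \<open>
  The generalized inverse is the left-continuous one. By continuity of the distribution function
  the initial positions are pairwise distinct.
\<close>

definition init_quantile :: "(real \<Rightarrow> real) \<Rightarrow> real \<Rightarrow> real" where
  "init_quantile f0 u = Inf {x. 0 \<le> x \<and> u \<le> init_cdf f0 x}"

definition init_position :: "(real \<Rightarrow> real) \<Rightarrow> nat \<Rightarrow> nat \<Rightarrow> real" where
  "init_position f0 n k = init_quantile f0 ((2 * real k - 1) / (2 * real n))"


section \<open>The particle system\<close>

text \<open>
  Particles at distinct positions never meet, so a configuration is the finite set of current
  positions. \<open>removal_law m C\<close> is the law of the path $t \mapsto$ configuration at time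
  $t$ started from a set \<open>C\<close> of \<open>2 * m\<close> points in $(0,\infty)$. The left-most particle
  hits \<open>0\<close> at time \<open>Min C\<close>, is removed together with a particle \<open>y\<close> (labelled by its
  position at time \<open>0\<close>) chosen uniformly among the others, and the system restarts from
  the remaining particles. Paths are right-continuous: at a removal time both particles are gone.
\<close>

primrec removal_law :: "nat \<Rightarrow> real set \<Rightarrow> (real \<Rightarrow> real set) pmf" where
  "removal_law 0 C = return_pmf (\<lambda>t. {})"
| "removal_law (Suc m) C = (let h = Min C in do {
     y \<leftarrow> pmf_of_set (C - {h});
     X \<leftarrow> removal_law m ((\<lambda>x. x - h) ` (C - {h, y}));
     return_pmf (\<lambda>t. if t < h then (\<lambda>x. x - t) ` C else X (t - h))
   })"

definition particle_law :: "(real \<Rightarrow> real) \<Rightarrow> nat \<Rightarrow> (real \<Rightarrow> real set) pmf" where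
  "particle_law f0 n = removal_law (n div 2) (init_position f0 n ` {1..n})"

definition joint_law :: "(real \<Rightarrow> real) \<Rightarrow> (nat \<Rightarrow> real \<Rightarrow> real set) measure" where
  "joint_law f0 = (\<Pi>\<^sub>M n\<in>{n. even n \<and> 2 \<le> n}. measure_pmf (particle_law f0 n))"

text \<open>
  The push-forward of counting measure on \<open>C\<close> is the sum of the unit point masses at the
  points of \<open>C\<close>.
\<close>

definition empirical_measure :: "nat \<Rightarrow> real set \<Rightarrow> real measure" where
  "empirical_measure n C = scale_measure (ennreal (1 / real n)) (distr (count_space C) halfline (\<lambda>x. x))"


lemma integral_empirical_measure:
  assumes "finite C" "C \<subseteq> {0..}" "\<phi> \<in> borel_measurable halfline"
  shows "integral\<^sup>L (empirical_measure n C) \<phi> = (\<Sum>x\<in>C. \<phi> x) / real n"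
proof -
  let ?D = "distr (count_space C) halfline (\<lambda>x. x)"
  have m: "(\<lambda>x. x) \<in> count_space C \<rightarrow>\<^sub>M halfline"
    using assms(2) by (auto simp: space_restrict_space)
  have "empirical_measure n C = density ?D (\<lambda>_. ennreal (1 / real n))"
    unfolding empirical_measure_def
    by (rule measure_eqI) (auto simp: emeasure_density nn_integral_cmult_indicator)
  then have "integral\<^sup>L (empirical_measure n C) \<phi> = (LINT x|?D. (1 / real n) *\<^sub>R \<phi> x)"
    using assms(3) by (simp only:) (rule integral_density, auto)
  also have "\<dots> = (LINT x|count_space C. (1 / real n) *\<^sub>R \<phi> x)"
    using assms(3) by (intro integral_distr[OF m]) auto
  also have "\<dots> = (\<Sum>x\<in>C. \<phi> x) / real n"
    using assms(1) by (simp add: lebesgue_integral_count_space_finite sum_divide_distrib)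
  finally show ?thesis .
qed

end

theory Submission imports Defs begin

text \<open>
  The removals pair up the particles, and a particle is still present at time \<open>t\<close> exactly if both
  it and its partner started beyond \<open>t\<close>. Partners are uniformly distributed and a fraction close
  to \<open>\<rho> t\<close> of the particles starts beyond \<open>t\<close>, so each of these survives with probability
  close to \<open>\<rho> t\<close>. Hence the proportion of particles that at time \<open>t\<close> are to the right of
  \<open>u \<ge> 0\<close> should be close to \<open>\<rho> t * \<rho> (t + u)\<close>, which is the mass of $(u,\infty)$ under the
  limiting measure.

  For fixed \<open>t\<close> and \<open>u\<close> this is a concentration statement. If \<open>n\<close> particles are present,
  \<open>k\<close> of them beyond \<open>t\<close> and \<open>b\<close> of them beyond \<open>t + u\<close>, the expected number of
  survivors to the right of \<open>u\<close> is \<open>b * (k - 1) / (n - 1)\<close>. Along the successive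
  removals this is a martingale with increments bounded by 4
  (\<open>expected_survivors_step\<close>), so Hoeffding's lemma bounds the exponential moments of the
  fluctuation by induction on the number of removals (\<open>removal_law_mgf\<close>), and the
  probability of a deviation of order \<open>n\<close> decays exponentially in \<open>n\<close>. The
  Borel-Cantelli lemma only looks at one system at a time and gives almost sure
  convergence, simultaneously for all rational \<open>t\<close> and \<open>u\<close>
  (\<open>AE_survivor_frequency\<close>).

  The rest concerns a single realization. At a fixed rational time, replacing a test function by
  a step function bounds the difference of its integrals by the differences of finitely many
  tails, uniformly over the unit ball of the bounded Lipschitz norm
  (\<open>integral_close_of_tails_close\<close>). To pass to all times in a compact interval, label
  the particles by their initial positions: the set of survivors then only decreases. Between two
  neighbouring grid times an integral therefore moves by at most the time step, from the common
  translation, plus the mass lost between the grid times, and this mass is small because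
  \<open>\<rho>\<close> is continuous (\<open>uniform_in_time_close\<close>).
\<close>

section \<open>Concentration of the number of survivors\<close>

text \<open>
  The hypotheses are invariant under \<open>f \<mapsto> - f\<close>, so the exponential parameter may have either
  sign. The values lie in an interval of length \<open>2 * c\<close>, whence the constant
  \<open>(2 * c)\<^sup>2 / 8\<close>.
\<close>

lemma Hoeffdings_lemma_uniform:
  fixes f :: "'a \<Rightarrow> real"
  assumes S: "finite S" "S \<noteq> {}" and mean: "(\<Sum>y\<in>S. f y) = 0"
    and bound: "\<And>y. y \<in> S \<Longrightarrow> \<bar>f y\<bar> \<le> c"
  shows "(\<integral>\<^sup>+y. ennreal (exp (l * f y)) \<partial>measure_pmf (pmf_of_set S)) \<le> ennreal (exp (l\<^sup>2 * c\<^sup>2 / 2))"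
proof -
  have pos: "(\<integral>\<^sup>+y. ennreal (exp (k * g y)) \<partial>measure_pmf (pmf_of_set S)) \<le> ennreal (exp (k\<^sup>2 * c\<^sup>2 / 2))"
    if "0 < k" "(\<Sum>y\<in>S. g y) = 0" "\<And>y. y \<in> S \<Longrightarrow> \<bar>g y\<bar> \<le> c" for k :: real and g :: "'a \<Rightarrow> real"
  proof -
    interpret interval_bounded_random_variable "measure_pmf (pmf_of_set S)" g "- c" c
    proof
      show "AE y in measure_pmf (pmf_of_set S). g y \<in> {- c..c}"
        using S that(3) by (auto simp: AE_measure_pmf_iff abs_le_iff) (metis minus_le_iff)
    qed simp
    have "measure_pmf.expectation (pmf_of_set S) g = 0"
      using S that(2) by (simp add: integral_pmf_of_set)
    from Hoeffdings_lemma_nn_integral_0[OF that(1) this]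
    show ?thesis
      by (simp add: power2_eq_square field_simps)
  qed
  consider "0 < l" | "l = 0" | "l < 0" by linarith
  then show ?thesis
  proof cases
    case 1
    then show ?thesis using pos[of l f] mean bound by simp
  next
    case 2
    then show ?thesis by simp
  next
    case 3
    then show ?thesis using pos[of "- l" "\<lambda>y. - f y"] mean bound by (simp add: sum_negf)
  qed
qed

text \<open>
  The conditional expectation, given that the particles are at the points of \<open>C\<close> now, of the
  number of particles to the right of \<open>u\<close> after a further time \<open>t\<close>: each of the particles
  beyond \<open>t + u\<close> survives iff its partner, uniform among the \<open>card C - 1\<close> others, is one of
  the remaining particles beyond \<open>t\<close>.
\<close>

definition expected_survivors :: "real set \<Rightarrow> real \<Rightarrow> real \<Rightarrow> real" where
  "expected_survivors C t u =
     real (card {c \<in> C. t + u < c}) * (real (card {c \<in> C. t < c}) - 1) / (real (card C) - 1)"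

lemma card_shifted_tail:
  fixes C :: "real set"
  assumes "finite C" "h \<le> s" "y \<in> C"
  shows "real (card {c \<in> (\<lambda>x. x - h) ` (C - {h, y}). s - h < c})
    = real (card {c \<in> C. s < c}) - of_bool (s < y)"
proof -
  have "{c \<in> (\<lambda>x. x - h) ` (C - {h, y}). s - h < c} = (\<lambda>x. x - h) ` ({c \<in> C. s < c} - {y})"
    using assms(2) by auto
  then have "card {c \<in> (\<lambda>x. x - h) ` (C - {h, y}). s - h < c} = card ({c \<in> C. s < c} - {y})"
    by (simp add: card_image inj_on_def)
  also have "real \<dots> = real (card {c \<in> C. s < c}) - of_bool (s < y)"
  proof (cases "s < y")
    case True
    then have "y \<in> {c \<in> C. s < c}" using assms by simp
    then have "card ({c \<in> C. s < c} - {y}) = card {c \<in> C. s < c} - 1" "card {c \<in> C. s < c} > 0"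
      using assms by (auto simp: card_gt_0_iff)
    then show ?thesis using True by simp
  qed auto
  finally show ?thesis .
qed

lemma card_pair_removed:
  fixes C :: "real set"
  assumes "finite C" "card C = 2 * Suc m" "h \<in> C" "y \<in> C - {h}"
  shows "card ((\<lambda>x. x - h) ` (C - {h, y})) = 2 * m"
  using assms by (simp add: card_image inj_on_def card_Diff_subset)

text \<open>
  The martingale property and the bounded increments. Removing \<open>y\<close> together with the left-most
  particle lowers the two counts by the indicators of \<open>t + u < y\<close> and \<open>t < y\<close>, and the
  first indicator is at most the second. The sum over \<open>y\<close> is thus elementary, and in the
  increment the two expectations, multiplied by their respective denominators, differ by a quantity
  that is linear in the counts.
\<close>

lemma expected_survivors_step:
  fixes C :: "real set" and t u :: real
  assumes C: "finite C" "card C = 2 * Suc m" and t: "Min C \<le> t" and u: "0 \<le> u"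
  defines "h \<equiv> Min C"
  defines "e \<equiv> \<lambda>y. expected_survivors ((\<lambda>x. x - h) ` (C - {h, y})) (t - h) u - expected_survivors C t u"
  shows "(\<Sum>y\<in>C - {h}. e y) = 0" and "\<And>y. y \<in> C - {h} \<Longrightarrow> \<bar>e y\<bar> \<le> 4"
proof -
  define b where "b = real (card {c \<in> C. t + u < c})"
  define k where "k = real (card {c \<in> C. t < c})"
  define n where "n = real (card C)"
  have ne: "C \<noteq> {}" using C by auto
  have hC: "h \<in> C" using C ne by (auto simp: h_def)
  have e_eq: "e y = (b - of_bool (t + u < y)) * (k - 1 - of_bool (t < y)) / (n - 3)
      - b * (k - 1) / (n - 1)" if "y \<in> C - {h}" for y
  proof -
    have "{c \<in> (\<lambda>x. x - h) ` (C - {h, y}). t - h + u < c} = {c \<in> (\<lambda>x. x - h) ` (C - {h, y}). (t + u) - h < c}"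
      by (simp add: algebra_simps)
    then show ?thesis
      using card_pair_removed[OF C hC that] card_shifted_tail[OF C(1), of h "t + u" y]
        card_shifted_tail[OF C(1), of h t y] that t u C(2)
      by (simp add: e_def expected_survivors_def h_def[symmetric] b_def k_def n_def)
  qed
  have sub: "{c \<in> C. t + u < c} \<subseteq> {c \<in> C. t < c}" "{c \<in> C. t < c} \<subseteq> C - {h}"
    using u t by (auto simp: h_def)
  have bk: "0 \<le> b" "b \<le> k"
    using card_mono[OF _ sub(1)] C by (auto simp: b_def k_def)
  have kn: "k \<le> n - 1"
    using card_mono[OF _ sub(2)] C hC by (simp add: k_def n_def)
  have n: "n = 2 * real m + 2"
    using C(2) by (simp add: n_def)
  have n3: "n \<noteq> 3"
  proof
    assume "n = 3"
    then have "2 * m + 2 = (3 :: nat)" using n by linarith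
    then show False by presburger
  qed
  have sumk: "(\<Sum>y\<in>C - {h}. of_bool (t < y) :: real) = k"
  proof -
    have "(C - {h}) \<inter> {y. t < y} = {c \<in> C. t < c}" using sub by auto
    then show ?thesis using C by (simp add: sum.If_cases of_bool_def k_def)
  qed
  have sumb: "(\<Sum>y\<in>C - {h}. of_bool (t + u < y) :: real) = b"
  proof -
    have "(C - {h}) \<inter> {y. t + u < y} = {c \<in> C. t + u < c}" using sub by auto
    then show ?thesis using C by (simp add: sum.If_cases of_bool_def b_def)
  qed
  have cardh: "real (card (C - {h})) = n - 1"
    using C hC by (simp add: n_def)
  have "(\<Sum>y\<in>C - {h}. (b - of_bool (t + u < y)) * (k - 1 - of_bool (t < y)))
      = (\<Sum>y\<in>C - {h}. b * (k - 1) - b * of_bool (t < y) - (k - 2) * of_bool (t + u < y))"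
    using u by (intro sum.cong refl) (auto simp: algebra_simps)
  also have "\<dots> = (n - 1) * (b * (k - 1)) - b * k - (k - 2) * b"
    by (simp add: sum_subtractf sum_distrib_left[symmetric] sumk sumb cardh)
  also have "\<dots> = b * (k - 1) * (n - 3)"
    by (simp add: algebra_simps)
  finally have mean: "(\<Sum>y\<in>C - {h}. (b - of_bool (t + u < y)) * (k - 1 - of_bool (t < y)))
      = b * (k - 1) * (n - 3)" .
  have "(\<Sum>y\<in>C - {h}. e y) = (\<Sum>y\<in>C - {h}. (b - of_bool (t + u < y)) * (k - 1 - of_bool (t < y)) / (n - 3)
      - b * (k - 1) / (n - 1))"
    by (intro sum.cong refl e_eq)
  also have "\<dots> = b * (k - 1) * (n - 3) / (n - 3) - (n - 1) * (b * (k - 1) / (n - 1))"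
    by (simp only: sum_subtractf sum_divide_distrib[symmetric] mean sum_constant cardh
        times_divide_eq_right)
  also have "\<dots> = 0"
    using n n3 by simp
  finally show "(\<Sum>y\<in>C - {h}. e y) = 0" .

  show "\<bar>e y\<bar> \<le> 4" if y: "y \<in> C - {h}" for y
  proof -
    have k0: "b = 0 \<and> \<not> t < y" if "k < 1"
    proof
      show "b = 0" using that bk by (simp add: b_def)
      have "{c \<in> C. t < c} = {}" using that C by (simp add: k_def)
      then show "\<not> t < y" using y by blast
    qed
    show ?thesis
    proof (cases "k < 1")
      case True
      then show ?thesis using k0[OF True] u by (simp add: e_eq[OF y])
    next
      case False
      then have k1: "1 \<le> k" by simp
      show ?thesis
      \<comment> \<open>The last two particles: then \<open>n - 3\<close> is negative, but both expectations vanish.\<close>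
      proof (cases "m = 0")
        case True
        then have "n = 2" using n by simp
        then have "k = 1" using kn k1 by simp
        moreover have "t < y"
        proof -
          have "card {c \<in> C. t < c} = 1" "card (C - {h}) = 1"
            using \<open>k = 1\<close> \<open>n = 2\<close> cardh by (simp_all add: k_def)
          then have "{c \<in> C. t < c} = C - {h}"
            using sub(2) C by (intro card_subset_eq) auto
          then show ?thesis using y by blast
        qed
        moreover have "b = of_bool (t + u < y)"
        proof -
          have "card (C - {h}) = 1" using \<open>n = 2\<close> cardh by simp
          then obtain z where z: "C - {h} = {z}" by (rule card_1_singletonE)
          have "y \<in> {z}" using y unfolding z .
          then have "C - {h} = {y}" using z by simp
          then show ?thesis using sumb by (simp only: sum.insert sum.empty finite.emptyI empty_iff add_0_right simp_thms)
        qed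
        ultimately show ?thesis by (simp add: e_eq[OF y])
      next
        case False
        \<comment> \<open>The new expectation is \<open>(v * (n - 1) - d) / (n - 3)\<close>, so the increment is
          \<open>(2 * v - d) / (n - 3)\<close>, and both \<open>2 * v\<close> and \<open>d\<close> lie between \<open>0\<close>
          and \<open>2 * (n - 2)\<close>.\<close>
        define v where "v = b * (k - 1) / (n - 1)"
        define d where "d = b * of_bool (t < y) + (k - 2) * of_bool (t + u < y)"
        have n4: "4 \<le> n" using False n by simp
        have v0: "0 \<le> v" using bk k1 n4 by (simp add: v_def)
        have "v \<le> b * (n - 2) / (n - 1)"
          unfolding v_def using bk kn n4 by (intro divide_right_mono mult_left_mono) auto
        also have "\<dots> = (b / (n - 1)) * (n - 2)" by simp
        also have "\<dots> \<le> 1 * (n - 2)"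
          using bk kn n4 by (intro mult_right_mono) auto
        finally have v1: "v \<le> n - 2" by simp
        have d1: "d \<le> 2 * (n - 2)"
          using bk kn n4 k1 u by (auto simp: d_def of_bool_def)
        have d0: "0 \<le> d"
        proof -
          have "1 \<le> b" if "t + u < y"
          proof -
            have "y \<in> {c \<in> C. t + u < c}" using that y by simp
            then have "0 < card {c \<in> C. t + u < c}" using C by (auto simp: card_gt_0_iff)
            then show ?thesis by (simp add: b_def)
          qed
          then show ?thesis using bk k1 u by (auto simp: d_def of_bool_def)
        qed
        have vn: "v * (n - 1) = b * (k - 1)" using n4 by (simp add: v_def)
        have "(b - of_bool (t + u < y)) * (k - 1 - of_bool (t < y)) = v * (n - 1) - d"
          unfolding vn using u by (auto simp: d_def of_bool_def algebra_simps)
        then have "e y = (v * (n - 1) - d) / (n - 3) - v"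
          by (simp add: e_eq[OF y] v_def)
        also have "\<dots> = (2 * v - d) / (n - 3)"
          using n4 by (simp add: field_simps)
        finally have "\<bar>e y\<bar> = \<bar>2 * v - d\<bar> / (n - 3)"
          using n4 by (simp add: abs_divide)
        also have "\<dots> \<le> 2 * (n - 2) / (n - 3)"
          using v0 v1 d0 d1 n4 by (intro divide_right_mono) auto
        also have "\<dots> \<le> 4"
          using n4 by (simp add: field_simps)
        finally show ?thesis .
      qed
    qed
  qed
qed

text \<open>
  Induction on the number of removals. Before the first removal the configuration is deterministic
  and the fluctuation is zero. Otherwise the fluctuation is the sum of the first martingale
  increment and of the fluctuation of the restarted system; the increment contributes a factor
  \<open>exp (l\<^sup>2 * 4\<^sup>2 / 2)\<close> by Hoeffding's lemma. All exponents \<open>l\<close> are admitted because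
  both tails are needed.
\<close>

lemma removal_law_mgf:
  assumes "finite C" "card C = 2 * m" "0 \<le> t" "0 \<le> u"
  shows "(\<integral>\<^sup>+X. ennreal (exp (l * (real (card (X t \<inter> {u<..})) - expected_survivors C t u)))
      \<partial>measure_pmf (removal_law m C)) \<le> ennreal (exp (8 * l\<^sup>2 * real m))"
  using assms
proof (induction m arbitrary: C t)
  case 0
  then show ?case by (simp add: expected_survivors_def)
next
  case (Suc m)
  define h where "h = Min C"
  have hC: "h \<in> C" using Suc.prems unfolding h_def by (intro Min_in) auto
  define S where "S = C - {h}"
  have card_S: "card S = 2 * m + 1"
    using Suc.prems hC by (simp add: S_def)
  have "0 < card S" using card_S by simp
  then have S: "finite S" "S \<noteq> {}" by (auto simp: card_gt_0_iff)
  define C' where "C' = (\<lambda>y. (\<lambda>x. x - h) ` (C - {h, y}))"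
  let ?I = "\<lambda>f. (\<integral>\<^sup>+X. ennreal (exp (l * f X)) \<partial>measure_pmf (removal_law (Suc m) C))"
  let ?v = "expected_survivors C t u"
  have law: "(\<integral>\<^sup>+X. F X \<partial>measure_pmf (removal_law (Suc m) C))
     = (\<integral>\<^sup>+y. \<integral>\<^sup>+X. F (\<lambda>s. if s < h then (\<lambda>x. x - s) ` C else X (s - h)) \<partial>removal_law m (C' y)
          \<partial>measure_pmf (pmf_of_set S))" for F :: "(real \<Rightarrow> real set) \<Rightarrow> ennreal"
    by (simp add: Let_def h_def[symmetric] S_def[symmetric] C'_def)
  show ?case
  proof (cases "t < h")
    case True
    then have gt: "t < c" if "c \<in> C" for c
      using Min_le[OF Suc.prems(1) that] by (simp add: h_def)
    have "(\<lambda>x. x - t) ` C \<inter> {u<..} = (\<lambda>x. x - t) ` {c \<in> C. t + u < c}" by auto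
    then have "card ((\<lambda>x. x - t) ` C \<inter> {u<..}) = card {c \<in> C. t + u < c}"
      by (simp add: card_image inj_on_def)
    moreover have "{c \<in> C. t < c} = C" using gt by auto
    ultimately have "real (card ((\<lambda>x. x - t) ` C \<inter> {u<..})) - ?v = 0"
      using Suc.prems by (simp add: expected_survivors_def)
    then have "?I (\<lambda>X. real (card (X t \<inter> {u<..})) - ?v) = 1"
      unfolding law using True by simp
    then show ?thesis by simp
  next
    case False
    then have th: "h \<le> t" by simp
    define e where "e = (\<lambda>y. expected_survivors (C' y) (t - h) u - ?v)"
    have mean: "(\<Sum>y\<in>S. e y) = 0" and bound: "\<And>y. y \<in> S \<Longrightarrow> \<bar>e y\<bar> \<le> 4"
      using expected_survivors_step[OF Suc.prems(1,2) th[unfolded h_def] Suc.prems(4)]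
      unfolding e_def S_def C'_def h_def by blast+
    have "?I (\<lambda>X. real (card (X t \<inter> {u<..})) - ?v)
      = (\<integral>\<^sup>+y. \<integral>\<^sup>+X. ennreal (exp (l * (real (card (X (t - h) \<inter> {u<..})) - ?v))) \<partial>removal_law m (C' y)
          \<partial>measure_pmf (pmf_of_set S))"
      unfolding law using False by simp
    also have "\<dots> \<le> (\<integral>\<^sup>+y. ennreal (exp (l * e y)) * ennreal (exp (8 * l\<^sup>2 * real m)) \<partial>measure_pmf (pmf_of_set S))"
    proof (rule nn_integral_mono_AE, subst AE_measure_pmf_iff, rule ballI)
      fix y assume "y \<in> set_pmf (pmf_of_set S)"
      then have y: "y \<in> C - {h}" using S by (simp add: S_def)
      have C': "finite (C' y)" "card (C' y) = 2 * m"
        using Suc.prems card_pair_removed[OF Suc.prems(1,2) hC y] by (simp_all add: C'_def)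
      have "(\<integral>\<^sup>+X. ennreal (exp (l * (real (card (X (t - h) \<inter> {u<..})) - ?v))) \<partial>removal_law m (C' y))
        = (\<integral>\<^sup>+X. ennreal (exp (l * e y)) * ennreal (exp (l * (real (card (X (t - h) \<inter> {u<..}))
             - expected_survivors (C' y) (t - h) u))) \<partial>removal_law m (C' y))"
        by (intro nn_integral_cong) (simp add: e_def algebra_simps flip: ennreal_mult exp_add)
      also have "\<dots> = ennreal (exp (l * e y)) * (\<integral>\<^sup>+X. ennreal (exp (l * (real (card (X (t - h) \<inter> {u<..}))
             - expected_survivors (C' y) (t - h) u))) \<partial>removal_law m (C' y))"
        by (simp add: nn_integral_cmult)
      also have "\<dots> \<le> ennreal (exp (l * e y)) * ennreal (exp (8 * l\<^sup>2 * real m))"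
        using th by (intro mult_left_mono Suc.IH C' Suc.prems) auto
      finally show "(\<integral>\<^sup>+X. ennreal (exp (l * (real (card (X (t - h) \<inter> {u<..})) - ?v))) \<partial>removal_law m (C' y))
        \<le> ennreal (exp (l * e y)) * ennreal (exp (8 * l\<^sup>2 * real m))" .
    qed
    also have "\<dots> = (\<integral>\<^sup>+y. ennreal (exp (l * e y)) \<partial>measure_pmf (pmf_of_set S)) * ennreal (exp (8 * l\<^sup>2 * real m))"
      by (simp add: nn_integral_multc)
    also have "\<dots> \<le> ennreal (exp (l\<^sup>2 * 4\<^sup>2 / 2)) * ennreal (exp (8 * l\<^sup>2 * real m))"
      by (intro mult_right_mono Hoeffdings_lemma_uniform S mean bound) auto
    also have "\<dots> = ennreal (exp (8 * l\<^sup>2 * real (Suc m)))"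
      by (simp add: algebra_simps flip: ennreal_mult exp_add)
    finally show ?thesis .
  qed
qed

text \<open>
  Chernoff's bound: the exponent \<open>- 2 * l * r * m + 8 * l\<^sup>2 * m\<close> is smallest at \<open>l = r / 8\<close>.
\<close>

lemma removal_law_concentration:
  assumes "finite C" "card C = 2 * m" "0 \<le> t" "0 \<le> u" "0 < r"
  shows "measure_pmf.prob (removal_law m C)
      {X. 2 * r * real m \<le> \<bar>real (card (X t \<inter> {u<..})) - expected_survivors C t u\<bar>}
    \<le> 2 * exp (- (r\<^sup>2 / 8) * real m)"
proof -
  let ?P = "measure_pmf (removal_law m C)"
  define D where "D = (\<lambda>X :: real \<Rightarrow> real set. real (card (X t \<inter> {u<..})) - expected_survivors C t u)"
  have one: "emeasure ?P {X. 2 * r * real m \<le> s * D X} \<le> ennreal (exp (- (r\<^sup>2 / 8) * real m))"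
    if "\<bar>s\<bar> = 1" for s
  proof -
    have s2: "s\<^sup>2 = 1" using that by (metis one_power2 power2_abs)
    have "emeasure ?P {X \<in> UNIV. 2 * r * real m \<le> s * D X}
      \<le> ennreal (exp (- (r / 8) * (2 * r * real m)))
         * (\<integral>\<^sup>+X. ennreal (exp ((r / 8) * (s * D X))) * indicator UNIV X \<partial>?P)"
      using assms by (intro Chernoff_ineq_nn_integral_ge) auto
    also have "\<dots> \<le> ennreal (exp (- (r / 8) * (2 * r * real m))) * ennreal (exp (8 * (r / 8 * s)\<^sup>2 * real m))"
      using removal_law_mgf[OF assms(1-4), of "r / 8 * s"]
      by (intro mult_left_mono) (auto simp: D_def mult.assoc)
    also have "\<dots> = ennreal (exp (- (r\<^sup>2 / 8) * real m))"
      unfolding power_mult_distrib s2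
      by (simp flip: ennreal_mult exp_add) (simp add: power2_eq_square field_simps)
    finally show ?thesis by simp
  qed
  have "emeasure ?P {X. 2 * r * real m \<le> \<bar>D X\<bar>}
    \<le> emeasure ?P ({X. 2 * r * real m \<le> 1 * D X} \<union> {X. 2 * r * real m \<le> - 1 * D X})"
    by (intro emeasure_mono) auto
  also have "\<dots> \<le> emeasure ?P {X. 2 * r * real m \<le> 1 * D X} + emeasure ?P {X. 2 * r * real m \<le> - 1 * D X}"
    by (intro emeasure_subadditive) auto
  also have "\<dots> \<le> ennreal (exp (- (r\<^sup>2 / 8) * real m)) + ennreal (exp (- (r\<^sup>2 / 8) * real m))"
    by (intro add_mono one) auto
  also have "\<dots> = ennreal (2 * exp (- (r\<^sup>2 / 8) * real m))"
    by (simp flip: ennreal_plus)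
  finally show ?thesis
    by (simp add: measure_pmf.emeasure_eq_measure D_def)
qed

section \<open>Paths of the particle system\<close>

text \<open>
  The sample path properties that hold with probability 1. Adding \<open>t\<close> to the positions at time \<open>t\<close>
  labels the particles by their positions at time \<open>0\<close>; in these labels the configuration can
  only shrink.
\<close>

definition removal_path :: "real set \<Rightarrow> (real \<Rightarrow> real set) \<Rightarrow> bool" where
  "removal_path C X \<longleftrightarrow>
     (\<forall>t\<ge>0. X t \<subseteq> {0<..} \<and> (+) t ` X t \<subseteq> C) \<and>
     (\<forall>s t. 0 \<le> s \<longrightarrow> s \<le> t \<longrightarrow> (+) t ` X t \<subseteq> (+) s ` X s)"

lemma removal_pathD:
  assumes "removal_path C X" "0 \<le> t"
  shows "X t \<subseteq> {0<..}" "(+) t ` X t \<subseteq> C" "\<And>s. 0 \<le> s \<Longrightarrow> s \<le> t \<Longrightarrow> (+) t ` X t \<subseteq> (+) s ` X s"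
  using assms unfolding removal_path_def by auto

lemma removal_law_path:
  assumes "finite C" "card C = 2 * m" "X \<in> set_pmf (removal_law m C)"
  shows "removal_path C X"
  using assms
proof (induction m arbitrary: C X)
  case 0
  then show ?case by (simp add: removal_path_def)
next
  case (Suc m)
  define h where "h = Min C"
  have "0 < card C" using Suc.prems by simp
  then have ne: "C \<noteq> {}" by auto
  then have hC: "h \<in> C" using Suc.prems unfolding h_def by (intro Min_in) auto
  have hmin: "h \<le> c" if "c \<in> C" for c using Suc.prems that by (simp add: h_def)
  have "C \<noteq> {h}" using Suc.prems by auto
  then have S: "finite (C - {h})" "C - {h} \<noteq> {}" using Suc.prems hC by auto
  obtain y X' where y: "y \<in> C - {h}"
    and X': "X' \<in> set_pmf (removal_law m ((\<lambda>x. x - h) ` (C - {h, y})))"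
    and X: "X = (\<lambda>t. if t < h then (\<lambda>x. x - t) ` C else X' (t - h))"
    using Suc.prems(3) S by (auto simp: Let_def h_def[symmetric])
  have path: "removal_path ((\<lambda>x. x - h) ` (C - {h, y})) X'"
    using Suc.prems hC y by (intro Suc.IH X') (auto simp: card_image inj_on_def card_Diff_subset)
  note D = removal_pathD[OF path]
  have shift: "(+) t ` A = (+) h ` (+) (t - h) ` A" for t and A :: "real set"
    by (force simp: image_image)
  show ?case
    unfolding removal_path_def
  proof (intro conjI allI impI)
    fix t :: real assume t: "0 \<le> t"
    show "X t \<subseteq> {0<..}"
    proof (cases "t < h")
      case True
      then show ?thesis using less_le_trans[OF True hmin] by (auto simp: X)
    next
      case False
      then show ?thesis using D(1)[of "t - h"] by (simp add: X)
    qed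
    show "(+) t ` X t \<subseteq> C"
    proof (cases "t < h")
      case False
      then have "(+) t ` X t \<subseteq> (+) h ` (\<lambda>x. x - h) ` (C - {h, y})"
        unfolding shift[of t] using D(2)[of "t - h"] by (auto simp: X)
      then show ?thesis by (auto simp: image_image)
    qed (auto simp: X)
  next
    fix s t :: real assume st: "0 \<le> s" "s \<le> t"
    show "(+) t ` X t \<subseteq> (+) s ` X s"
    proof (cases "s < h")
      case True
      have "(+) t ` X t \<subseteq> C"
      proof (cases "t < h")
        case False
        then have "(+) t ` X t \<subseteq> (+) h ` (\<lambda>x. x - h) ` (C - {h, y})"
          unfolding shift[of t] using D(2)[of "t - h"] by (auto simp: X)
        then show ?thesis by (auto simp: image_image)
      qed (auto simp: X)
      also have "C = (+) s ` X s" using True by (force simp: X image_image)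
      finally show ?thesis .
    next
      case False
      then show ?thesis
        unfolding shift[of t] shift[of s] using D(3)[of "t - h" "s - h"] st
        by (auto simp: X)
    qed
  qed
qed

lemma removal_path_card:
  assumes "removal_path C X" "finite C" "0 \<le> t"
  shows "finite (X t)" "card (X t) \<le> card C"
proof -
  have sub: "(+) t ` X t \<subseteq> C" using removal_pathD(2)[OF assms(1,3)] .
  then have "finite ((+) t ` X t)" using assms(2) by (rule finite_subset)
  then show "finite (X t)" by (rule finite_imageD) simp
  show "card (X t) \<le> card C" using card_mono[OF assms(2) sub] by (simp add: card_image)
qed

section \<open>The initial density and its quantiles\<close>

locale initial_density =
  fixes f0 :: "real \<Rightarrow> real"
  assumes integrable_f0: "set_integrable lebesgue {0<..} f0"
    and f0_nonneg: "AE y in lebesgue. 0 < y \<longrightarrow> 0 \<le> f0 y"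
    and integral_f0: "(LINT y:{0<..}|lebesgue. f0 y) = 1"
begin

abbreviation \<mu>\<^sub>0 :: "real measure" where "\<mu>\<^sub>0 \<equiv> init_measure f0"
abbreviation F :: "real \<Rightarrow> real" where "F \<equiv> init_cdf f0"
abbreviation \<rho> :: "real \<Rightarrow> real" where "\<rho> \<equiv> survival f0"

lemma sets_init_measure [simp, measurable_cong]: "sets \<mu>\<^sub>0 = sets halfline"
  by (simp add: init_measure_def)

lemma space_init_measure [simp]: "space \<mu>\<^sub>0 = {0..}"
  by (simp add: init_measure_def space_restrict_space)

text \<open>
  The point \<open>0\<close> belongs to the half-line but not to the domain of the density.
\<close>

lemma emeasure_init_measure:
  assumes A: "A \<in> sets borel" "A \<subseteq> {0..}"
  shows "emeasure \<mu>\<^sub>0 A = ennreal (LINT y:A \<inter> {0<..}|lebesgue. f0 y)"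
proof -
  let ?L = "lebesgue_on {0<..} :: real measure"
  have int: "integrable ?L f0"
    using integrable_f0 by (subst integrable_restrict_space) (auto simp: set_integrable_def)
  have posL: "AE y in ?L. 0 \<le> f0 y"
    using f0_nonneg by (subst AE_restrict_space_iff) auto
  have "(\<lambda>y. y) \<in> ?L \<rightarrow>\<^sub>M halfline"
  proof (rule measurable_restrict_space2)
    show "(\<lambda>y. y) \<in> ?L \<rightarrow>\<^sub>M borel"
      by (intro measurable_restrict_space1 measurable_completion) simp
  qed (auto simp: space_restrict_space)
  then have m: "(\<lambda>y. y) \<in> density ?L (\<lambda>y. ennreal (f0 y)) \<rightarrow>\<^sub>M halfline"
    by simp
  have S: "A \<inter> {0<..} \<in> sets ?L"
    using A by (subst sets_restrict_space_iff) auto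
  have "emeasure \<mu>\<^sub>0 A = emeasure (density ?L (\<lambda>y. ennreal (f0 y))) (A \<inter> {0<..})"
    unfolding init_measure_def using A
    by (subst emeasure_distr[OF m])
      (auto simp: sets_halfline_iff space_restrict_space intro!: arg_cong[where f="emeasure _"])
  also have "\<dots> = (\<integral>\<^sup>+y. ennreal (f0 y) * indicator (A \<inter> {0<..}) y \<partial>?L)"
    using int S by (intro emeasure_density) auto
  also have "\<dots> = (\<integral>\<^sup>+y. ennreal (f0 y * indicator (A \<inter> {0<..}) y) \<partial>?L)"
    by (intro nn_integral_cong) (auto simp: indicator_def)
  also have "\<dots> = ennreal (LINT y|?L. f0 y * indicator (A \<inter> {0<..}) y)"
    using posL by (intro nn_integral_eq_integral integrable_real_mult_indicator int S) auto
  also have "(LINT y|?L. f0 y * indicator (A \<inter> {0<..}) y) = (LINT y:A \<inter> {0<..}|lebesgue. f0 y)"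
    unfolding set_lebesgue_integral_def
    by (subst integral_restrict_space)
      (auto intro!: Bochner_Integration.integral_cong simp: indicator_def)
  finally show ?thesis .
qed

lemma set_integral_f0_nonneg: "0 \<le> (LINT y:A \<inter> {0<..}|lebesgue. f0 y)"
  unfolding set_lebesgue_integral_def using f0_nonneg
  by (intro integral_nonneg_AE) (auto simp: indicator_def elim!: eventually_mono)

lemma measure_init_measure_eq:
  assumes "A \<in> sets borel" "A \<subseteq> {0..}"
  shows "measure \<mu>\<^sub>0 A = (LINT y:A \<inter> {0<..}|lebesgue. f0 y)"
  by (simp add: measure_def emeasure_init_measure[OF assms] set_integral_f0_nonneg)

sublocale init: prob_space \<mu>\<^sub>0
proof
  have "{0..} \<inter> {0<..} = {0 :: real<..}" by auto
  then show "emeasure \<mu>\<^sub>0 (space \<mu>\<^sub>0) = 1"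
    by (simp add: emeasure_init_measure integral_f0)
qed

lemma init_no_atoms: "0 \<le> x \<Longrightarrow> measure \<mu>\<^sub>0 {x} = 0"
proof -
  assume "0 \<le> x"
  then have "measure \<mu>\<^sub>0 {x} = (LINT y:{x} \<inter> {0<..}|lebesgue. f0 y)"
    by (intro measure_init_measure_eq) auto
  also have "\<dots> = 0"
  proof -
    have "AE y in lebesgue. y \<noteq> x"
      by (rule AE_completion) (rule AE_lborel_singleton)
    then have "AE y in lebesgue. indicator ({x} \<inter> {0<..}) y *\<^sub>R f0 y = 0"
      by eventually_elim (auto simp: indicator_def)
    then show ?thesis
      unfolding set_lebesgue_integral_def by (rule integral_eq_zero_AE)
  qed
  finally show ?thesis .
qed

lemma survival_eq_measure: "0 \<le> t \<Longrightarrow> \<rho> t = measure \<mu>\<^sub>0 {t<..}"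
proof -
  assume "0 \<le> t"
  then have "{t<..} \<inter> {0<..} = {t<..}" "{t<..} \<subseteq> {0..}" by auto
  then show ?thesis by (simp add: measure_init_measure_eq survival_def)
qed

lemma init_cdf_eq_measure: "0 \<le> x \<Longrightarrow> F x = measure \<mu>\<^sub>0 {0..x}"
proof -
  assume x: "0 \<le> x"
  have "measure \<mu>\<^sub>0 ({0..<x} \<union> {x}) = measure \<mu>\<^sub>0 {0..<x} + measure \<mu>\<^sub>0 {x}"
    using x by (intro init.finite_measure_Union) (auto simp: sets_halfline_iff)
  moreover have "{0..<x} \<union> {x} = {0..x}" using x by auto
  ultimately show ?thesis
    using measure_init_measure[OF integrable_f0 f0_nonneg, of x] init_no_atoms[OF x] by simp
qed

lemma survival_eq: "0 \<le> t \<Longrightarrow> \<rho> t = 1 - F t"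
proof -
  assume t: "0 \<le> t"
  have "{t<..} = space \<mu>\<^sub>0 - {0..t}" using t by auto
  then show ?thesis
    using t init.prob_compl[of "{0..t}"] survival_eq_measure[OF t] init_cdf_eq_measure[OF t]
    by (simp add: sets_halfline_iff)
qed

text \<open>
  Transport to a measure on the whole line, where monotonicity, the limit at infinity and the
  equivalence of continuity with the absence of atoms are properties of distribution functions.
\<close>

lemma init_cdf_eq_cdf: "F = cdf (distr \<mu>\<^sub>0 borel (\<lambda>x. x))"
proof
  fix x
  have m: "(\<lambda>x. x) \<in> \<mu>\<^sub>0 \<rightarrow>\<^sub>M borel"
    by (simp cong: measurable_cong_sets add: measurable_restrict_space1)
  have "cdf (distr \<mu>\<^sub>0 borel (\<lambda>x. x)) x = measure \<mu>\<^sub>0 ({..x} \<inter> {0..})"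
    unfolding cdf_def by (subst measure_distr[OF m]) (auto intro: arg_cong[where f = "measure \<mu>\<^sub>0"])
  also have "\<dots> = F x"
  proof (cases "0 \<le> x")
    case True
    then have "{..x} \<inter> {0..} = {0..x}" by auto
    then show ?thesis using init_cdf_eq_measure[OF True] by simp
  next
    case False
    then have "{..x} \<inter> {0..} = {}" "{0<..<x} = {}" by auto
    then show ?thesis by (simp add: init_cdf_def set_lebesgue_integral_def)
  qed
  finally show "F x = cdf (distr \<mu>\<^sub>0 borel (\<lambda>x. x)) x" by simp
qed

lemma real_distribution_init: "real_distribution (distr \<mu>\<^sub>0 borel (\<lambda>x. x))"
  by (intro init.real_distribution_distr) (simp cong: measurable_cong_sets add: measurable_restrict_space1)

lemma init_cdf_mono: "x \<le> y \<Longrightarrow> F x \<le> F y"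
  and init_cdf_nonneg: "0 \<le> F x"
  and init_cdf_le_1: "F x \<le> 1"
  and init_cdf_at_top: "(F \<longlongrightarrow> 1) at_top"
  and isCont_init_cdf: "isCont F x"
proof -
  interpret M: real_distribution "distr \<mu>\<^sub>0 borel (\<lambda>x. x)" by (rule real_distribution_init)
  show "x \<le> y \<Longrightarrow> F x \<le> F y" "0 \<le> F x" "F x \<le> 1" "(F \<longlongrightarrow> 1) at_top"
    unfolding init_cdf_eq_cdf
    by (rule M.cdf_nondecreasing M.cdf_nonneg M.cdf_bounded_prob M.cdf_lim_at_top_prob; assumption?)+
  have m: "(\<lambda>x. x) \<in> \<mu>\<^sub>0 \<rightarrow>\<^sub>M borel"
    by (simp cong: measurable_cong_sets add: measurable_restrict_space1)
  have "measure (distr \<mu>\<^sub>0 borel (\<lambda>x. x)) {x} = measure \<mu>\<^sub>0 ({x} \<inter> {0..})"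
    by (subst measure_distr[OF m]) (auto intro: arg_cong[where f = "measure \<mu>\<^sub>0"])
  also have "\<dots> = 0"
    using init_no_atoms[of x] by (cases "0 \<le> x") auto
  finally show "isCont F x"
    unfolding init_cdf_eq_cdf M.isCont_cdf .
qed

lemma init_cdf_0: "F 0 = 0"
  by (simp add: init_cdf_def set_lebesgue_integral_def)

text \<open>
  Both parts use that the infimum defining the quantile is attained, by continuity of the
  distribution function; the second also uses the intermediate value theorem.
\<close>

lemma init_quantile:
  assumes p: "0 < p" "p < 1"
  shows less_init_quantile_iff: "0 \<le> u \<Longrightarrow> u < init_quantile f0 p \<longleftrightarrow> F u < p"
    and init_cdf_init_quantile: "F (init_quantile f0 p) = p"
proof -
  define A where "A = {x. 0 \<le> x \<and> p \<le> F x}"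
  have cont: "continuous_on S F" for S
    using isCont_init_cdf by (auto simp: continuous_at_imp_continuous_on)
  have "A = {0..} \<inter> F -` {p..}" by (auto simp: A_def)
  then have cl: "closed A"
    using continuous_on_closed_vimage[of UNIV F] cont[of UNIV] by (auto intro!: closed_Int)
  have "eventually (\<lambda>x. p < F x) at_top"
    using init_cdf_at_top p(2) by (rule order_tendstoD(1))
  then have "eventually (\<lambda>x. 0 \<le> x \<and> p < F x) at_top"
    using eventually_ge_at_top[of 0] by eventually_elim simp
  then obtain x where "0 \<le> x" "p < F x"
    using eventually_happens[of _ "at_top :: real filter"] by auto
  then have ne: "A \<noteq> {}" by (auto simp: A_def intro!: exI[of _ x])
  have bdd: "bdd_below A" by (auto simp: A_def bdd_below_def)
  have q: "init_quantile f0 p = Inf A" by (simp add: init_quantile_def A_def)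
  have QA: "init_quantile f0 p \<in> A"
    unfolding q by (rule closed_contains_Inf[OF ne bdd cl])
  have QL: "init_quantile f0 p \<le> x" if "x \<in> A" for x
    unfolding q using that bdd by (rule cInf_lower)
  show "u < init_quantile f0 p \<longleftrightarrow> F u < p" if "0 \<le> u"
  proof
    assume "u < init_quantile f0 p"
    then have "u \<notin> A" using QL[of u] by auto
    then show "F u < p" using that by (auto simp: A_def)
  next
    assume "F u < p"
    then show "u < init_quantile f0 p"
      using QA init_cdf_mono[of "init_quantile f0 p" u] by (auto simp: A_def not_less[symmetric])
  qed
  have "\<exists>x. 0 \<le> x \<and> x \<le> init_quantile f0 p \<and> F x = p"
    using QA p init_cdf_0 by (intro IVT' cont) (auto simp: A_def)
  then obtain x where x: "0 \<le> x" "x \<le> init_quantile f0 p" "F x = p" by auto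
  then have "init_quantile f0 p = x" using QL[of x] by (auto simp: A_def)
  then show "F (init_quantile f0 p) = p" using x by simp
qed

lemma level_in_unit_interval:
  assumes "k \<in> {1..n}"
  shows "0 < (2 * real k - 1) / (2 * real n)" "(2 * real k - 1) / (2 * real n) < 1"
proof -
  have "1 \<le> real k" "real k \<le> real n" using assms by auto
  then show "0 < (2 * real k - 1) / (2 * real n)" "(2 * real k - 1) / (2 * real n) < 1"
    by (simp_all add: divide_less_eq)
qed

lemma inj_on_init_position: "inj_on (init_position f0 n) {1..n}"
proof (rule inj_onI)
  fix k l assume k: "k \<in> {1..n}" and l: "l \<in> {1..n}" and eq: "init_position f0 n k = init_position f0 n l"
  have level: "F (init_position f0 n i) = (2 * real i - 1) / (2 * real n)" if "i \<in> {1..n}" for i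
    unfolding init_position_def by (rule init_cdf_init_quantile[OF level_in_unit_interval[OF that]])
  have "(2 * real k - 1) / (2 * real n) = (2 * real l - 1) / (2 * real n)"
    using level[OF k] level[OF l] unfolding eq by (rule trans[OF sym])
  then have "2 * real k - 1 = 2 * real l - 1"
    using k by (subst (asm) divide_cancel_right) auto
  then show "k = l" by simp
qed

lemma card_init_position: "card (init_position f0 n ` {1..n}) = n"
  using card_image[OF inj_on_init_position[of n]] by simp

text \<open>
  The \<open>k\<close>-th particle starts beyond \<open>u\<close> iff \<open>k > n * F u + 1 / 2\<close>, which leaves a
  rounding error only.
\<close>

lemma init_position_tail:
  assumes u: "0 \<le> u"
  shows "\<bar>real (card {c \<in> init_position f0 n ` {1..n}. u < c}) - real n * \<rho> u\<bar> \<le> 1"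
proof -
  \<comment> \<open>The number of particles that start in $[0,u]$.\<close>
  define q where "q = nat \<lfloor>real n * F u + 1 / 2\<rfloor>"
  have x0: "0 \<le> real n * F u" using init_cdf_nonneg by simp
  have x1: "real n * F u \<le> real n" using mult_left_mono[OF init_cdf_le_1[of u], of "real n"] by simp
  have q: "real q \<le> real n * F u + 1 / 2" "real n * F u + 1 / 2 < real q + 1"
    unfolding q_def using x0 by linarith+
  have qn: "q \<le> n" using q x1 by linarith
  have "{c \<in> init_position f0 n ` {1..n}. u < c} = init_position f0 n ` {Suc q..n}"
  proof -
    have "u < init_position f0 n k \<longleftrightarrow> Suc q \<le> k" if k: "k \<in> {1..n}" for k
    proof -
      have "u < init_position f0 n k \<longleftrightarrow> F u < (2 * real k - 1) / (2 * real n)"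
        unfolding init_position_def by (rule less_init_quantile_iff[OF level_in_unit_interval[OF k] u])
      also have "\<dots> \<longleftrightarrow> real n * F u + 1 / 2 < real k"
        using k by (auto simp: field_simps)
      also have "\<dots> \<longleftrightarrow> Suc q \<le> k"
      proof
        assume "real n * F u + 1 / 2 < real k"
        then show "Suc q \<le> k" using q(1) by linarith
      next
        assume "Suc q \<le> k"
        then have "real q + 1 \<le> real k" by linarith
        then show "real n * F u + 1 / 2 < real k" using q(2) by linarith
      qed
      finally show ?thesis .
    qed
    then show ?thesis by fastforce
  qed
  then have "card {c \<in> init_position f0 n ` {1..n}. u < c} = card {Suc q..n}"
    by (simp add: card_image inj_on_subset[OF inj_on_init_position])
  then have "real (card {c \<in> init_position f0 n ` {1..n}. u < c}) = real n - real q"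
    using qn by (simp add: of_nat_diff)
  moreover have "real n * \<rho> u = real n - real n * F u"
    using survival_eq[OF u] by (simp add: right_diff_distrib)
  ultimately show ?thesis
    using q by linarith
qed

end

section \<open>Almost sure convergence of the tail frequencies\<close>

abbreviation evens :: "nat filter" where "evens \<equiv> inf sequentially (principal {n. even n})"

lemma eventually_evensI:
  assumes "\<And>n. even n \<Longrightarrow> 2 \<le> n \<Longrightarrow> P n"
  shows "eventually P evens"
  unfolding eventually_inf_principal
  using eventually_ge_at_top[of 2] by eventually_elim (use assms in auto)

context initial_density
begin

lemma tail_frequency_limit:
  assumes "0 \<le> u"
  shows "(\<lambda>n. real (card {c \<in> init_position f0 n ` {1..n}. u < c}) / real n) \<longlonglongrightarrow> \<rho> u"
proof -
  have "(\<lambda>n. real (card {c \<in> init_position f0 n ` {1..n}. u < c}) / real n - \<rho> u) \<longlonglongrightarrow> 0"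
  proof (rule Lim_null_comparison)
    show "\<forall>\<^sub>F n in sequentially. norm (real (card {c \<in> init_position f0 n ` {1..n}. u < c}) / real n - \<rho> u)
        \<le> 1 / real n"
      using eventually_gt_at_top[of 0]
    proof eventually_elim
      case (elim n)
      have "real (card {c \<in> init_position f0 n ` {1..n}. u < c}) / real n - \<rho> u
        = (real (card {c \<in> init_position f0 n ` {1..n}. u < c}) - real n * \<rho> u) / real n"
        using elim by (simp add: diff_divide_distrib)
      then show ?case
        using divide_right_mono[OF init_position_tail[OF assms, of n], of "real n"]
        by (simp only: real_norm_def abs_divide abs_of_nat of_nat_0_le_iff)
    qed
    show "(\<lambda>n. 1 / real n) \<longlonglongrightarrow> 0" by (rule lim_1_over_n)
  qed
  then show ?thesis by (simp add: LIM_zero_iff)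
qed

lemma expected_survivors_limit:
  assumes "0 \<le> t" "0 \<le> u"
  shows "(\<lambda>n. expected_survivors (init_position f0 n ` {1..n}) t u / real n) \<longlonglongrightarrow> \<rho> t * \<rho> (t + u)"
proof -
  define b where "b = (\<lambda>n. real (card {c \<in> init_position f0 n ` {1..n}. t + u < c}))"
  define k where "k = (\<lambda>n. real (card {c \<in> init_position f0 n ` {1..n}. t < c}))"
  have "(\<lambda>n. (k n / real n - 1 / real n) / (1 - 1 / real n) * (b n / real n)) \<longlonglongrightarrow> (\<rho> t - 0) / (1 - 0) * \<rho> (t + u)"
    unfolding b_def k_def using assms
    by (intro tendsto_mult tendsto_divide tendsto_diff tail_frequency_limit lim_1_over_n tendsto_const) auto
  moreover have "\<forall>\<^sub>F n in sequentially. (k n / real n - 1 / real n) / (1 - 1 / real n) * (b n / real n)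
      = expected_survivors (init_position f0 n ` {1..n}) t u / real n"
    using eventually_gt_at_top[of 1]
  proof eventually_elim
    case (elim n)
    have "(k n / real n - 1 / real n) / (1 - 1 / real n) = (k n - 1) / (real n - 1)"
      using elim by (simp add: field_simps)
    then show ?case
      by (simp only: expected_survivors_def card_init_position b_def k_def) simp
  qed
  ultimately show ?thesis
    by (simp add: tendsto_cong)
qed

lemma product_prob_space_particle_laws:
  "product_prob_space (\<lambda>n. measure_pmf (particle_law f0 n))"
  by (intro product_prob_spaceI) (rule prob_space_measure_pmf)

text \<open>
  The events that the fluctuation at fixed \<open>t\<close> and \<open>u\<close> is at least \<open>r * n\<close> have
  geometrically decaying probabilities, and each depends on a single coordinate of the product
  space.
\<close>

lemma AE_survivor_frequency:
  assumes t: "0 \<le> t" and u: "0 \<le> u"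
  shows "AE \<omega> in joint_law f0.
    ((\<lambda>n. real (card (\<omega> n t \<inter> {u<..})) / real n) \<longlongrightarrow> \<rho> t * \<rho> (t + u)) evens"
proof -
  interpret product_prob_space "\<lambda>n. measure_pmf (particle_law f0 n)" "{n. even n \<and> 2 \<le> n}"
    by (rule product_prob_space_particle_laws)
  interpret J: prob_space "joint_law f0"
    unfolding joint_law_def by unfold_locales
  define E where "E = (\<lambda>n. expected_survivors (init_position f0 n ` {1..n}) t u)"
  define bad where "bad = (\<lambda>r n. {X :: real \<Rightarrow> real set. r * real n \<le> \<bar>real (card (X t \<inter> {u<..})) - E n\<bar>})"
  have AE_r: "AE \<omega> in joint_law f0. \<forall>\<^sub>F n in evens. \<bar>real (card (\<omega> n t \<inter> {u<..})) / real n - E n / real n\<bar> < r"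
    if r: "0 < r" for r
  proof -
    define A where "A = (\<lambda>n. {\<omega> \<in> space (joint_law f0). even n \<and> 2 \<le> n \<and> \<omega> n \<in> bad r n})"
    \<comment> \<open>There are \<open>n / 2\<close> removals, which turns the rate \<open>r\<^sup>2 / 8\<close> per removal into
      \<open>r\<^sup>2 / 16\<close>.\<close>
    have A: "A n \<in> sets (joint_law f0) \<and> measure (joint_law f0) (A n) \<le> 2 * exp (- (r\<^sup>2 / 16)) ^ n" for n
    proof (cases "even n \<and> 2 \<le> n")
      case True
      then have n: "n \<in> {n. even n \<and> 2 \<le> n}" by simp
      have A_eq: "A n = {\<omega> \<in> space (joint_law f0). \<omega> n \<in> bad r n}" using True by (simp add: A_def)
      have "(\<lambda>\<omega>. \<omega> n) \<in> joint_law f0 \<rightarrow>\<^sub>M measure_pmf (particle_law f0 n)"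
        unfolding joint_law_def by (rule measurable_component_singleton[OF n])
      from measurable_sets[OF this, of "bad r n"] have sets: "A n \<in> sets (joint_law f0)"
        by (simp add: A_eq vimage_def Int_def conj_commute)
      have "emeasure (joint_law f0) (A n) = emeasure (measure_pmf (particle_law f0 n)) (bad r n)"
        unfolding A_eq joint_law_def by (rule emeasure_PiM_Collect_single[OF n]) simp
      then have "measure (joint_law f0) (A n) = measure_pmf.prob (particle_law f0 n) (bad r n)"
        by (simp add: measure_def)
      also have "\<dots> \<le> 2 * exp (- (r\<^sup>2 / 8) * real (n div 2))"
      proof -
        have n2: "2 * real (n div 2) = real n" using True by (metis of_nat_mult of_nat_numeral dvd_mult_div_cancel)
        have "r * real n = 2 * r * real (n div 2)" unfolding n2[symmetric] by simp
        then have "bad r n = {X. 2 * r * real (n div 2) \<le> \<bar>real (card (X t \<inter> {u<..})) - E n\<bar>}"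
          by (simp only: bad_def)
        moreover have "finite (init_position f0 n ` {1..n})"
          and "card (init_position f0 n ` {1..n}) = 2 * (n div 2)"
          using True by (simp_all only: card_init_position finite_imageI finite_atLeastAtMost dvd_mult_div_cancel)
        note removal_law_concentration[OF this t u r]
        ultimately show ?thesis by (simp only: particle_law_def E_def)
      qed
      also have "\<dots> = 2 * exp (- (r\<^sup>2 / 16)) ^ n"
      proof -
        have "real (n div 2) = real n / 2" using True by (auto elim!: evenE)
        then show ?thesis by (simp flip: exp_of_nat_mult)
      qed
      finally show ?thesis using sets by simp
    next
      case False
      then have "A n = {}" by (auto simp: A_def)
      then show ?thesis by simp
    qed
    have "summable (\<lambda>n. measure (joint_law f0) (A n))"
    proof (rule summable_comparison_test')
      show "summable (\<lambda>n. 2 * exp (- (r\<^sup>2 / 16)) ^ n)"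
        using r by (intro summable_mult summable_geometric) auto
      show "norm (measure (joint_law f0) (A n)) \<le> 2 * exp (- (r\<^sup>2 / 16)) ^ n" if "0 \<le> n" for n
        using A[of n] by simp
    qed
    then have "AE \<omega> in joint_law f0. \<forall>\<^sub>F n in sequentially. \<omega> \<in> space (joint_law f0) - A n"
      using A by (intro borel_cantelli_AE1) (auto simp: J.emeasure_eq_measure)
    then show ?thesis
    proof eventually_elim
      case (elim \<omega>)
      then show ?case
        unfolding eventually_inf_principal using eventually_ge_at_top[of 2]
      proof eventually_elim
        case (elim n)
        show ?case
        proof
          assume "n \<in> {n. even n}"
          then have "\<omega> n \<notin> bad r n" using elim by (auto simp: A_def)
          then have "\<bar>real (card (\<omega> n t \<inter> {u<..})) - E n\<bar> / real n < r"
            using elim by (simp add: bad_def pos_divide_less_eq)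
          then show "\<bar>real (card (\<omega> n t \<inter> {u<..})) / real n - E n / real n\<bar> < r"
            by (simp add: diff_divide_distrib[symmetric])
        qed
      qed
    qed
  qed
  have "AE \<omega> in joint_law f0. \<forall>j::nat. \<forall>\<^sub>F n in evens.
      \<bar>real (card (\<omega> n t \<inter> {u<..})) / real n - E n / real n\<bar> < 1 / real (Suc j)"
    unfolding AE_all_countable by (intro allI AE_r) simp
  then show ?thesis
  proof eventually_elim
    case (elim \<omega>)
    have "((\<lambda>n. real (card (\<omega> n t \<inter> {u<..})) / real n - E n / real n) \<longlongrightarrow> 0) evens"
    proof (rule tendstoI)
      fix e :: real assume "0 < e"
      then obtain j where j: "1 / real (Suc j) < e"
        using reals_Archimedean[of e] by (auto simp: inverse_eq_divide)
      from elim[rule_format, of j]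
      show "\<forall>\<^sub>F n in evens. dist (real (card (\<omega> n t \<inter> {u<..})) / real n - E n / real n) 0 < e"
        by (rule eventually_mono) (use j in \<open>simp add: dist_real_def\<close>)
    qed
    moreover have "((\<lambda>n. E n / real n) \<longlongrightarrow> \<rho> t * \<rho> (t + u)) evens"
      unfolding E_def by (rule tendsto_mono[OF inf_le1 expected_survivors_limit[OF t u]])
    ultimately show ?case
      using tendsto_add by fastforce
  qed
qed

lemma AE_removal_path:
  "AE \<omega> in joint_law f0. \<forall>n. even n \<longrightarrow> 2 \<le> n \<longrightarrow> removal_path (init_position f0 n ` {1..n}) (\<omega> n)"
  unfolding AE_all_countable
proof
  fix n
  show "AE \<omega> in joint_law f0. even n \<longrightarrow> 2 \<le> n \<longrightarrow> removal_path (init_position f0 n ` {1..n}) (\<omega> n)"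
  proof (cases "even n \<and> 2 \<le> n")
    case True
    have "AE X in measure_pmf (particle_law f0 n). removal_path (init_position f0 n ` {1..n}) X"
      unfolding AE_measure_pmf_iff particle_law_def
    proof
      fix X assume "X \<in> set_pmf (removal_law (n div 2) (init_position f0 n ` {1..n}))"
      then show "removal_path (init_position f0 n ` {1..n}) X"
        using True by (intro removal_law_path) (simp_all add: card_init_position[simplified])
    qed
    then have "AE \<omega> in joint_law f0. removal_path (init_position f0 n ` {1..n}) (\<omega> n)"
      unfolding joint_law_def using True
      by (intro AE_PiM_component) (auto intro: prob_space_measure_pmf)
    then show ?thesis by eventually_elim simp
  qed auto
qed

end

section \<open>Bounded Lipschitz test functions\<close>

lemma bl_norm_le_1D:
  assumes "bl_norm \<phi> \<le> 1" "0 \<le> x"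
  shows "\<bar>\<phi> x\<bar> \<le> 1" and "0 \<le> y \<Longrightarrow> \<bar>\<phi> x - \<phi> y\<bar> \<le> \<bar>x - y\<bar>"
proof -
  define a where "a = (SUP x\<in>{0..}. ereal \<bar>\<phi> x\<bar>)"
  define D where "D = {(x :: real, y). 0 \<le> x \<and> 0 \<le> y \<and> x \<noteq> y}"
  define q where "q = (\<lambda>(x, y). ereal (\<bar>\<phi> x - \<phi> y\<bar> / \<bar>x - y\<bar>))"
  define b where "b = (SUP z\<in>D. q z)"
  have ab: "a + b \<le> 1"
    using assms(1) by (simp add: bl_norm_def a_def b_def D_def q_def case_prod_unfold)
  have ax: "ereal \<bar>\<phi> z\<bar> \<le> a" if "0 \<le> z" for z
    unfolding a_def using that by (intro SUP_upper) simp
  have bq: "q z \<le> b" if "z \<in> D" for z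
    unfolding b_def using that by (rule SUP_upper)
  have "0 \<le> a" using ax[of 0] by (rule order_trans[rotated]) simp_all
  moreover have "0 \<le> b"
    using bq[of "(0, 1)"] by (rule order_trans[rotated]) (simp_all add: D_def q_def)
  ultimately have a1: "a \<le> 1" and b1: "b \<le> 1"
    using ab add_increasing2[of b a a] add_increasing[of a b b] by (auto intro: order_trans)
  show "\<bar>\<phi> x\<bar> \<le> 1"
    using order_trans[OF ax[OF assms(2)] a1] by simp
  show "\<bar>\<phi> x - \<phi> y\<bar> \<le> \<bar>x - y\<bar>" if "0 \<le> y"
  proof (cases "x = y")
    case False
    then have "(x, y) \<in> D" using assms(2) that by (simp add: D_def)
    from order_trans[OF bq[OF this] b1] have "\<bar>\<phi> x - \<phi> y\<bar> / \<bar>x - y\<bar> \<le> 1"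
      by (simp add: q_def)
    then show ?thesis using False by (simp add: pos_divide_le_eq)
  qed simp
qed

lemma bl_norm_zero: "bl_norm (\<lambda>x. 0) \<le> 1"
proof -
  have "(0, 1) \<in> {(x :: real, y). 0 \<le> x \<and> 0 \<le> y \<and> x \<noteq> y}" by simp
  then have "{(x :: real, y). 0 \<le> x \<and> 0 \<le> y \<and> x \<noteq> y} \<noteq> {}" by blast
  then show ?thesis by (simp add: bl_norm_def case_prod_unfold)
qed

lemma bl_dist_nonneg: "0 \<le> bl_dist M N"
proof -
  have "ereal (integral\<^sup>L M (\<lambda>x. 0) - integral\<^sup>L N (\<lambda>x. 0)) \<le> bl_dist M N"
    unfolding bl_dist_def using bl_norm_zero by (intro SUP_upper) simp
  then show ?thesis by (simp add: zero_ereal_def)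
qed

text \<open>
  The unit ball of the bounded Lipschitz norm, with the two suprema unfolded. The values on the
  negative half-line are arbitrary.
\<close>

locale bl_test_function =
  fixes \<phi> :: "real \<Rightarrow> real"
  assumes bounded: "0 \<le> x \<Longrightarrow> \<bar>\<phi> x\<bar> \<le> 1"
    and lipschitz: "0 \<le> x \<Longrightarrow> 0 \<le> y \<Longrightarrow> \<bar>\<phi> x - \<phi> y\<bar> \<le> \<bar>x - y\<bar>"
begin

text \<open>
  Freezing the function to the left of \<open>0\<close> gives a function that is Lipschitz on the whole line,
  from which measurability on the half-line and of the shifted function follow.
\<close>

lemma continuous_extension: "continuous_on UNIV (\<lambda>x. \<phi> (max 0 x))"
proof -
  have "1-lipschitz_on UNIV (\<lambda>x. \<phi> (max 0 x))"
  proof (rule lipschitz_onI)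
    fix x y :: real
    have "\<bar>\<phi> (max 0 x) - \<phi> (max 0 y)\<bar> \<le> \<bar>max 0 x - max 0 y\<bar>"
      by (intro lipschitz) auto
    also have "\<dots> \<le> \<bar>x - y\<bar>" by linarith
    finally show "dist (\<phi> (max 0 x)) (\<phi> (max 0 y)) \<le> 1 * dist x y"
      by (simp add: dist_real_def)
  qed simp
  then show ?thesis by (rule lipschitz_on_continuous_on)
qed

lemma measurable_shift_fun: "shift_fun t \<phi> \<in> borel_measurable halfline"
proof -
  have "(\<lambda>x. if t \<le> x then \<phi> (max 0 (x - t)) else 0) \<in> borel_measurable borel"
    by (intro measurable_If borel_measurable_continuous_onI
        continuous_on_compose2[OF continuous_extension]) (auto intro!: continuous_intros)
  moreover have "shift_fun t \<phi> = (\<lambda>x. if t \<le> x then \<phi> (max 0 (x - t)) else 0)"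
    by (auto simp: shift_fun_def fun_eq_iff)
  ultimately show ?thesis
    by (simp add: measurable_restrict_space1)
qed

lemma measurable: "\<phi> \<in> borel_measurable halfline"
proof -
  have "\<phi> \<in> borel_measurable halfline \<longleftrightarrow> shift_fun 0 \<phi> \<in> borel_measurable halfline"
    by (intro measurable_cong) (simp add: space_restrict_space shift_fun_def)
  then show ?thesis using measurable_shift_fun by simp
qed

text \<open>
  The step function takes on each cell $(i\delta,(i+1)\delta]$ the value at the right end point
  and vanishes beyond $m\delta$. It is within \<open>\<delta>\<close> of the test function on the cells and
  within 1 of it in the tail; only an atom at \<open>0\<close>, which lies in no cell, has to be excluded.
\<close>

lemma integral_step_approx:
  assumes "finite_measure M" and sets [measurable_cong]: "sets M = sets halfline"
    and zero: "measure M {0} = 0" and \<delta>: "0 < \<delta>"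
  shows "\<bar>integral\<^sup>L M \<phi> - (\<Sum>i<m. \<phi> (real (Suc i) * \<delta>) *
      (measure M {real i * \<delta><..} - measure M {real (Suc i) * \<delta><..}))\<bar>
    \<le> \<delta> * measure M {0..} + measure M {real m * \<delta><..}"
proof -
  interpret finite_measure M by fact
  have sp: "space M = {0..}"
    using sets_eq_imp_space_eq[OF sets] by (simp add: space_restrict_space)
  have setsI: "A \<in> sets M" if "A \<in> sets borel" "A \<subseteq> {0..}" for A
    using that by (simp add: sets sets_halfline_iff)
  define I where "I = (\<lambda>i::nat. {real i * \<delta><..real (Suc i) * \<delta>})"
  have I_sub: "I i \<subseteq> {0..}" for i
  proof
    fix x assume "x \<in> I i"
    moreover have "0 \<le> real i * \<delta>" using \<delta> by simp
    ultimately show "x \<in> {0..}" unfolding I_def by simp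
  qed
  have I_sets [measurable]: "I i \<in> sets M" for i
    using I_sub by (intro setsI) (auto simp: I_def)
  have tail_sub: "{real i * \<delta><..} \<subseteq> {0..}" for i :: nat
    using \<delta> by (auto intro: order_trans[of 0 "real i * \<delta>"] less_imp_le)
  have tail_sets [measurable]: "{real i * \<delta><..} \<in> sets M" for i :: nat
    using tail_sub by (intro setsI) auto
  have measure_I: "measure M (I i) = measure M {real i * \<delta><..} - measure M {real (Suc i) * \<delta><..}" for i
  proof -
    have "I i = {real i * \<delta><..} - {real (Suc i) * \<delta><..}" by (auto simp: I_def)
    moreover have "{real (Suc i) * \<delta><..} \<subseteq> {real i * \<delta><..}"
      using \<delta> by (auto simp: algebra_simps)
    ultimately show ?thesis
      by (simp only: finite_measure_Diff[OF tail_sets tail_sets])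
  qed
  define \<psi> where "\<psi> = (\<lambda>x. \<Sum>i<m. \<phi> (real (Suc i) * \<delta>) * indicat_real (I i) x)"
  define g where "g = (\<lambda>x. \<delta> + indicat_real {real m * \<delta><..} x)"
  have \<phi>_int: "integrable M \<phi>"
  proof (rule integrable_const_bound)
    show "AE x in M. norm (\<phi> x) \<le> 1" using bounded by (intro AE_I2) (simp add: sp)
    show "\<phi> \<in> borel_measurable M" using measurable measurable_cong_sets[OF sets refl] by simp
  qed
  have \<psi>_int: "integrable M \<psi>"
    unfolding \<psi>_def by (intro Bochner_Integration.integrable_sum integrable_mult_right) (simp add: emeasure_eq_measure)
  have g_int: "integrable M g"
    unfolding g_def by (intro Bochner_Integration.integrable_add) (simp_all add: emeasure_eq_measure)
  have integral_\<psi>: "integral\<^sup>L M \<psi> = (\<Sum>i<m. \<phi> (real (Suc i) * \<delta>) *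
      (measure M {real i * \<delta><..} - measure M {real (Suc i) * \<delta><..}))"
    unfolding \<psi>_def measure_I[symmetric]
    by (subst Bochner_Integration.integral_sum) (simp_all add: emeasure_eq_measure)
  have close: "\<bar>\<phi> x - \<psi> x\<bar> \<le> g x" if x: "0 < x" for x
  proof -
    \<comment> \<open>The index of the cell that contains \<open>x\<close>.\<close>
    define j where "j = nat (\<lceil>x / \<delta>\<rceil> - 1)"
    have "0 < x / \<delta>" using x \<delta> by simp
    then have "real j < x / \<delta>" "x / \<delta> \<le> real j + 1"
      unfolding j_def by linarith+
    then have xj: "real j * \<delta> < x" "x \<le> real (Suc j) * \<delta>"
      using \<delta> by (simp_all add: field_simps)
    have ind: "indicat_real (I i) x = (if i = j then 1 else 0)" for i
    proof -
      have "x \<in> I i \<longleftrightarrow> i = j"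
      proof
        assume "x \<in> I i"
        then have "real i * \<delta> < x" "x \<le> real (Suc i) * \<delta>" by (simp_all add: I_def)
        then have "real i * \<delta> < real (Suc j) * \<delta>" "real j * \<delta> < real (Suc i) * \<delta>"
          using xj by linarith+
        then have "i < Suc j" "j < Suc i"
          using \<delta> by (simp_all only: mult_less_cancel_right_pos of_nat_less_iff)
        then show "i = j" by simp
      qed (use xj in \<open>simp add: I_def\<close>)
      then show ?thesis by (simp add: indicator_def)
    qed
    have "\<psi> x = (\<Sum>i<m. if i = j then \<phi> (real (Suc i) * \<delta>) else 0)"
      unfolding \<psi>_def ind by (intro sum.cong) auto
    then have \<psi>x: "\<psi> x = (if j < m then \<phi> (real (Suc j) * \<delta>) else 0)"
      by (simp only: sum.delta' sum.delta finite_lessThan lessThan_iff)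
    show ?thesis
    proof (cases "j < m")
      case True
      have "\<bar>\<phi> x - \<phi> (real (Suc j) * \<delta>)\<bar> \<le> \<bar>x - real (Suc j) * \<delta>\<bar>"
        using x \<delta> by (intro lipschitz) auto
      also have "\<dots> \<le> \<delta>" using xj by (simp add: algebra_simps)
      finally show ?thesis using True by (simp add: \<psi>x g_def indicator_def)
    next
      case False
      then have "real m * \<delta> \<le> real j * \<delta>" using \<delta> by simp
      then have "real m * \<delta> < x" using xj by simp
      then show ?thesis
        using False bounded[of x] x \<delta> by (simp add: \<psi>x g_def)
    qed
  qed
  have "AE x in M. x \<notin> {0}"
    using zero setsI[of "{0}"] by (intro AE_not_in) (auto simp: null_sets_def emeasure_eq_measure)
  then have pos: "AE x in M. 0 < x"
    using AE_space by eventually_elim (auto simp: sp)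
  have "\<bar>integral\<^sup>L M \<phi> - integral\<^sup>L M \<psi>\<bar> = \<bar>LINT x|M. \<phi> x - \<psi> x\<bar>"
    using \<phi>_int \<psi>_int by simp
  also have "\<dots> \<le> (LINT x|M. \<bar>\<phi> x - \<psi> x\<bar>)"
    by (rule integral_abs_bound)
  also have "\<dots> \<le> integral\<^sup>L M g"
    using pos close \<phi>_int \<psi>_int g_int by (intro integral_mono_AE) (auto elim!: eventually_mono)
  also have "\<dots> = \<delta> * measure M {0..} + measure M {real m * \<delta><..}"
    unfolding g_def by (subst Bochner_Integration.integral_add) (simp_all add: emeasure_eq_measure sp Int_absorb2[OF tail_sub])
  finally show ?thesis unfolding integral_\<psi> .
qed

text \<open>
  The bound does not depend on the test function, so closeness of finitely many tails yields
  closeness in the bounded Lipschitz distance, up to the mesh and the mass beyond the last cell.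
\<close>

lemma integral_close_of_tails_close:
  assumes M: "finite_measure M" "sets M = sets halfline" "measure M {0} = 0"
    and N: "finite_measure N" "sets N = sets halfline" "measure N {0} = 0" and \<delta>: "0 < \<delta>"
  shows "\<bar>integral\<^sup>L M \<phi> - integral\<^sup>L N \<phi>\<bar>
    \<le> \<delta> * (measure M {0..} + measure N {0..}) + measure M {real m * \<delta><..} + measure N {real m * \<delta><..}
      + 2 * (\<Sum>i\<le>m. \<bar>measure M {real i * \<delta><..} - measure N {real i * \<delta><..}\<bar>)"
proof -
  define a where "a = (\<lambda>i. measure M {real i * \<delta><..} - measure N {real i * \<delta><..})"
  define S where "S = (\<lambda>K. \<Sum>i<m. \<phi> (real (Suc i) * \<delta>) *
      (measure K {real i * \<delta><..} - measure K {real (Suc i) * \<delta><..}))"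
  have "\<bar>S M - S N\<bar> = \<bar>\<Sum>i<m. \<phi> (real (Suc i) * \<delta>) * (a i - a (Suc i))\<bar>"
    unfolding S_def a_def sum_subtractf[symmetric]
    by (intro arg_cong[where f = abs] sum.cong refl) (simp add: algebra_simps)
  also have "\<dots> \<le> (\<Sum>i<m. \<bar>a i\<bar> + \<bar>a (Suc i)\<bar>)"
  proof (rule order_trans[OF sum_abs], rule sum_mono)
    fix i
    have "\<bar>\<phi> (real (Suc i) * \<delta>)\<bar> \<le> 1" using \<delta> by (intro bounded) simp
    then have "\<bar>\<phi> (real (Suc i) * \<delta>)\<bar> * \<bar>a i - a (Suc i)\<bar> \<le> 1 * \<bar>a i - a (Suc i)\<bar>"
      by (intro mult_right_mono) auto
    also have "\<dots> \<le> \<bar>a i\<bar> + \<bar>a (Suc i)\<bar>" by simp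
    finally show "\<bar>\<phi> (real (Suc i) * \<delta>) * (a i - a (Suc i))\<bar> \<le> \<bar>a i\<bar> + \<bar>a (Suc i)\<bar>"
      by (simp add: abs_mult)
  qed
  also have "\<dots> = (\<Sum>i<m. \<bar>a i\<bar>) + (\<Sum>i<m. \<bar>a (Suc i)\<bar>)"
    by (rule sum.distrib)
  also have "\<dots> \<le> (\<Sum>i\<le>m. \<bar>a i\<bar>) + (\<Sum>i\<le>m. \<bar>a i\<bar>)"
  proof (rule add_mono)
    show "(\<Sum>i<m. \<bar>a i\<bar>) \<le> (\<Sum>i\<le>m. \<bar>a i\<bar>)" by (intro sum_mono2) auto
    show "(\<Sum>i<m. \<bar>a (Suc i)\<bar>) \<le> (\<Sum>i\<le>m. \<bar>a i\<bar>)"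
      using sum.lessThan_Suc_shift[of "\<lambda>i. \<bar>a i\<bar>" m] by (simp only: lessThan_Suc_atMost)
  qed
  finally have "\<bar>S M - S N\<bar> \<le> 2 * (\<Sum>i\<le>m. \<bar>a i\<bar>)" by simp
  moreover have "\<bar>integral\<^sup>L M \<phi> - S M\<bar> \<le> \<delta> * measure M {0..} + measure M {real m * \<delta><..}"
    unfolding S_def by (rule integral_step_approx[OF M \<delta>])
  moreover have "\<bar>integral\<^sup>L N \<phi> - S N\<bar> \<le> \<delta> * measure N {0..} + measure N {real m * \<delta><..}"
    unfolding S_def by (rule integral_step_approx[OF N \<delta>])
  ultimately show ?thesis
    unfolding a_def distrib_left by linarith
qed

end

lemma bl_test_function_if_bl_norm_le_1: "bl_norm \<phi> \<le> 1 \<Longrightarrow> bl_test_function \<phi>"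
  by unfold_locales (auto intro: bl_norm_le_1D)

section \<open>The empirical and the limiting measures\<close>

lemma sets_empirical_measure: "sets (empirical_measure n C) = sets halfline"
  by (simp add: empirical_measure_def)

lemma measure_empirical_measure:
  assumes "finite C" "C \<subseteq> {0..}" "A \<in> sets borel" "A \<subseteq> {0..}"
  shows "measure (empirical_measure n C) A = real (card (C \<inter> A)) / real n"
proof -
  have m: "(\<lambda>x. x) \<in> count_space C \<rightarrow>\<^sub>M halfline"
    using assms(2) by (auto simp: space_restrict_space)
  have "measure (distr (count_space C) halfline (\<lambda>x. x)) A = real (card (C \<inter> A))"
    using assms by (subst measure_distr[OF m]) (auto simp: sets_halfline_iff measure_count_space Int_commute)
  then show ?thesis
    unfolding empirical_measure_def by simp
qed

lemma finite_measure_empirical_measure: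
  assumes "finite C" "C \<subseteq> {0..}"
  shows "finite_measure (empirical_measure n C)"
proof
  have m: "(\<lambda>x. x) \<in> count_space C \<rightarrow>\<^sub>M halfline"
    using assms(2) by (auto simp: space_restrict_space)
  have "{0..} \<in> sets halfline" by (simp add: sets_halfline_iff)
  then have "emeasure (distr (count_space C) halfline (\<lambda>x. x)) {0..} = ennreal (real (card C))"
    using assms by (subst emeasure_distr[OF m]) (auto simp: emeasure_count_space Int_absorb1 ennreal_of_nat_eq_real_of_nat)
  then show "emeasure (empirical_measure n C) (space (empirical_measure n C)) \<noteq> \<infinity>"
    unfolding empirical_measure_def
    by (simp add: space_scale_measure space_restrict_space ennreal_mult_eq_top_iff)
qed

context bl_test_function
begin

text \<open>
  In the labels by initial positions, the particles present at time \<open>t\<close> are among those present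
  at time \<open>s\<close>. Each common particle has moved by \<open>t - s\<close>, and each particle lost in between
  counts at most 1. The loss is measured up to a later time \<open>v\<close>, so that the bound is uniform
  for \<open>t\<close> between two grid points.
\<close>

lemma sum_survivors_increment:
  assumes path: "removal_path C X" and C: "finite C" and t: "0 \<le> s" "s \<le> t" "t \<le> v"
  shows "\<bar>(\<Sum>x\<in>X t. \<phi> x) - (\<Sum>x\<in>X s. \<phi> x)\<bar>
    \<le> (t - s) * real (card C) + (real (card (X s)) - real (card (X v)))"
proof -
  define Y where "Y = (\<lambda>r. (+) r ` X r)"
  have Y_sub: "Y r \<subseteq> C" if "0 \<le> r" for r
    using removal_pathD(2)[OF path that] by (simp add: Y_def)
  have finY: "finite (Y r)" if "0 \<le> r" for r
    using Y_sub[OF that] C by (rule finite_subset)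
  have Y_mono: "Y r' \<subseteq> Y r" if "0 \<le> r" "r \<le> r'" for r r'
    using removal_pathD(3)[OF path _ that] that by (simp add: Y_def)
  have Y_gt: "r < y" if "y \<in> Y r" "0 \<le> r" for y r
    using that removal_pathD(1)[OF path that(2)] by (auto simp: Y_def)
  have card_Y: "card (Y r) = card (X r)" for r
    by (simp add: Y_def card_image)
  have sum_Y: "(\<Sum>x\<in>X r. \<phi> x) = (\<Sum>y\<in>Y r. \<phi> (y - r))" for r
    by (simp add: Y_def sum.reindex)
  have split: "(\<Sum>y\<in>Y s. \<phi> (y - s)) = (\<Sum>y\<in>Y s - Y t. \<phi> (y - s)) + (\<Sum>y\<in>Y t. \<phi> (y - s))"
    using t by (intro sum.subset_diff Y_mono finY) auto
  have "\<bar>(\<Sum>y\<in>Y t. \<phi> (y - t)) - (\<Sum>y\<in>Y t. \<phi> (y - s))\<bar> \<le> (\<Sum>y\<in>Y t. \<bar>\<phi> (y - t) - \<phi> (y - s)\<bar>)"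
    unfolding sum_subtractf[symmetric] by (rule sum_abs)
  also have "\<dots> \<le> (\<Sum>y\<in>Y t. t - s)"
  proof (rule sum_mono)
    fix y assume "y \<in> Y t"
    then have "t < y" using Y_gt t by simp
    then have "\<bar>\<phi> (y - t) - \<phi> (y - s)\<bar> \<le> \<bar>(y - t) - (y - s)\<bar>"
      using t by (intro lipschitz) auto
    then show "\<bar>\<phi> (y - t) - \<phi> (y - s)\<bar> \<le> t - s" using t by simp
  qed
  also have "\<dots> \<le> (t - s) * real (card C)"
    using card_mono[OF C Y_sub[of t]] t by (simp add: mult.commute mult_left_mono)
  finally have 1: "\<bar>(\<Sum>y\<in>Y t. \<phi> (y - t)) - (\<Sum>y\<in>Y t. \<phi> (y - s))\<bar> \<le> (t - s) * real (card C)" .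
  have "\<bar>\<Sum>y\<in>Y s - Y t. \<phi> (y - s)\<bar> \<le> (\<Sum>y\<in>Y s - Y t. 1)"
  proof (rule order_trans[OF sum_abs], rule sum_mono)
    fix y assume "y \<in> Y s - Y t"
    then have "s < y" using Y_gt t by simp
    then show "\<bar>\<phi> (y - s)\<bar> \<le> 1" by (intro bounded) simp
  qed
  also have "\<dots> \<le> (\<Sum>y\<in>Y s - Y v. 1)"
    using Y_mono[of t v] t finY[of s] by (intro sum_mono2) auto
  also have "\<dots> = real (card (X s)) - real (card (X v))"
    using Y_mono[of s v] finY[of v] finY[of s] t card_mono[of "Y s" "Y v"]
    by (simp add: card_Diff_subset card_Y of_nat_diff)
  finally have "\<bar>\<Sum>y\<in>Y s - Y t. \<phi> (y - s)\<bar> \<le> real (card (X s)) - real (card (X v))" .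
  then show ?thesis
    unfolding sum_Y split using 1 by linarith
qed

end

lemma measure_shift_measure_eq:
  assumes "sets \<mu> = sets halfline" "0 \<le> h" "A \<in> sets borel" "A \<subseteq> {0..}"
  shows "measure (shift_measure h \<mu>) A = measure \<mu> {x. h \<le> x \<and> x - h \<in> A}"
proof -
  have sp: "space \<mu> = {0..}"
    using sets_eq_imp_space_eq[OF assms(1)] by (simp add: space_restrict_space)
  have h_sets: "{h..} \<inter> space \<mu> \<in> sets \<mu>"
    unfolding assms(1) sets_halfline_iff sp by auto
  have "measure (shift_measure h \<mu>) A
      = measure (restrict_space \<mu> {h..}) ((\<lambda>y. y - h) -` A \<inter> space (restrict_space \<mu> {h..}))"
    unfolding shift_measure_def using assms(3,4)
    by (intro measure_distr[OF measurable_shift[OF assms(1,2)]]) (simp add: sets_halfline_iff)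
  also have "(\<lambda>y. y - h) -` A \<inter> space (restrict_space \<mu> {h..}) = {x. h \<le> x \<and> x - h \<in> A}"
    using assms(2) by (auto simp: space_restrict_space sp)
  also have "measure (restrict_space \<mu> {h..}) \<dots> = measure \<mu> \<dots>"
    by (rule measure_restrict_space[OF h_sets]) auto
  finally show ?thesis .
qed

context initial_density
begin

abbreviation limit_measure :: "real \<Rightarrow> real measure" where
  "limit_measure t \<equiv> scale_measure (ennreal (\<rho> t)) (shift_measure t \<mu>\<^sub>0)"

lemma survival_nonneg: "0 \<le> t \<Longrightarrow> 0 \<le> \<rho> t" and survival_le_1: "0 \<le> t \<Longrightarrow> \<rho> t \<le> 1"
  and survival_antimono: "0 \<le> s \<Longrightarrow> s \<le> t \<Longrightarrow> \<rho> t \<le> \<rho> s"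
  using init_cdf_nonneg[of t] init_cdf_le_1[of t] init_cdf_mono[of s t] by (simp_all add: survival_eq)

lemma survival_at_top: "(\<rho> \<longlongrightarrow> 0) at_top"
proof -
  have "((\<lambda>t. 1 - F t) \<longlongrightarrow> 1 - 1) at_top"
    by (intro tendsto_diff tendsto_const init_cdf_at_top)
  moreover have "\<forall>\<^sub>F t in at_top. 1 - F t = \<rho> t"
    using eventually_ge_at_top[of 0] by eventually_elim (simp add: survival_eq)
  ultimately show ?thesis by (simp add: tendsto_cong)
qed

lemma continuous_on_survival: "continuous_on {0..} \<rho>"
proof -
  have "continuous_on {0..} (\<lambda>t. 1 - F t)"
    using isCont_init_cdf by (intro continuous_intros) (auto simp: continuous_at_imp_continuous_on)
  then show ?thesis by (rule continuous_on_eq) (simp add: survival_eq)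
qed

lemma sets_limit_measure: "sets (limit_measure t) = sets halfline"
  by (simp add: shift_measure_def)

lemma finite_measure_limit_measure: "0 \<le> t \<Longrightarrow> finite_measure (limit_measure t)"
proof -
  assume t: "0 \<le> t"
  have "{t..} \<in> sets \<mu>\<^sub>0" using t by (auto simp: sets_halfline_iff)
  then have "finite_measure (restrict_space \<mu>\<^sub>0 {t..})"
    by (intro finite_measure_restrict_space init.finite_measure_axioms)
  then have "finite_measure (shift_measure t \<mu>\<^sub>0)"
    unfolding shift_measure_def
    by (rule finite_measure.finite_measure_distr) (intro measurable_shift t, simp)
  then interpret S: finite_measure "shift_measure t \<mu>\<^sub>0" .
  show ?thesis
    by standard (simp add: space_scale_measure S.emeasure_eq_measure ennreal_mult_eq_top_iff)
qed

lemma measure_limit_measure_tail: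
  assumes "0 \<le> t" "0 \<le> u"
  shows "measure (limit_measure t) {u<..} = \<rho> t * \<rho> (t + u)"
proof -
  have "{x. t \<le> x \<and> x - t \<in> {u<..}} = {t + u<..}" using assms by auto
  moreover have "{u<..} \<subseteq> {0..}" using assms by auto
  ultimately show ?thesis
    using assms by (simp add: measure_shift_measure_eq survival_nonneg survival_eq_measure)
qed

lemma measure_limit_measure_0:
  assumes "0 \<le> t"
  shows "measure (limit_measure t) {0} = 0"
proof -
  have "{x. t \<le> x \<and> x - t \<in> {0}} = {t}" using assms by auto
  then show ?thesis
    using assms by (simp add: measure_shift_measure_eq survival_nonneg init_no_atoms)
qed

lemma measure_limit_measure_total:
  assumes "0 \<le> t"
  shows "measure (limit_measure t) {0..} \<le> 1"
proof -
  have "measure (shift_measure t \<mu>\<^sub>0) {0..} \<le> 1"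
    using assms by (simp add: measure_shift_measure_eq init.prob_le_1)
  then have "\<rho> t * measure (shift_measure t \<mu>\<^sub>0) {0..} \<le> 1 * 1"
    using assms by (intro mult_mono survival_le_1) auto
  then show ?thesis using assms by (simp add: survival_nonneg)
qed

lemma integral_limit_measure:
  assumes "bl_test_function \<phi>" "0 \<le> t"
  shows "integral\<^sup>L (limit_measure t) \<phi> = \<rho> t * integral\<^sup>L \<mu>\<^sub>0 (shift_fun t \<phi>)"
proof -
  interpret bl_test_function \<phi> by fact
  have [measurable]: "\<phi> \<in> borel_measurable (shift_measure t \<mu>\<^sub>0)"
    using measurable by (simp add: shift_measure_def)
  have "limit_measure t = density (shift_measure t \<mu>\<^sub>0) (\<lambda>_. ennreal (\<rho> t))"
    by (rule measure_eqI) (auto simp: emeasure_density nn_integral_cmult_indicator)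
  then have "integral\<^sup>L (limit_measure t) \<phi> = (LINT x|shift_measure t \<mu>\<^sub>0. \<rho> t *\<^sub>R \<phi> x)"
    using survival_nonneg[OF assms(2)] by (simp only:) (rule integral_density, auto)
  also have "\<dots> = \<rho> t * integral\<^sup>L \<mu>\<^sub>0 (shift_fun t \<phi>)"
    using integral_shift_measure[OF _ assms(2) measurable, of \<mu>\<^sub>0] by simp
  finally show ?thesis .
qed

text \<open>
  The counterpart of \<open>sum_survivors_increment\<close> for the limit. Apart from the translation, the factor \<open>\<rho>\<close> and the
  shifted initial measure both change by \<open>\<rho> s - \<rho> t\<close>, the latter through the mass that reaches
  \<open>0\<close> between the times \<open>s\<close> and \<open>t\<close>.
\<close>

lemma integral_limit_measure_increment:
  assumes \<phi>: "bl_test_function \<phi>" and st: "0 \<le> s" "s \<le> t"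
  shows "\<bar>integral\<^sup>L (limit_measure t) \<phi> - integral\<^sup>L (limit_measure s) \<phi>\<bar> \<le> (t - s) + 2 * (\<rho> s - \<rho> t)"
proof -
  interpret bl_test_function \<phi> by fact
  have t: "0 \<le> t" using st by simp
  define A where "A = (\<lambda>r. integral\<^sup>L \<mu>\<^sub>0 (shift_fun r \<phi>))"
  have bound: "\<bar>shift_fun r \<phi> x\<bar> \<le> 1" for r x
    using bounded[of "x - r"] by (simp add: shift_fun_def)
  have meas: "shift_fun r \<phi> \<in> borel_measurable \<mu>\<^sub>0" for r
    using measurable_shift_fun by (simp cong: measurable_cong_sets)
  have int: "integrable \<mu>\<^sub>0 (shift_fun r \<phi>)" for r
    using bound meas by (intro init.integrable_const_bound[where B = 1]) auto
  have "\<bar>A s\<bar> \<le> (LINT x|\<mu>\<^sub>0. \<bar>shift_fun s \<phi> x\<bar>)"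
    unfolding A_def by (rule integral_abs_bound)
  also have "\<dots> \<le> (LINT x|\<mu>\<^sub>0. 1)"
    using int bound by (intro integral_mono) auto
  finally have A1: "\<bar>A s\<bar> \<le> 1" by (simp add: init.prob_space[simplified])
  have win: "{s..<t} \<in> sets \<mu>\<^sub>0" using st by (auto simp: sets_halfline_iff)
  have win_eq: "{s..<t} \<inter> {0..} = {s..<t}" using st by auto
  have gap: "measure \<mu>\<^sub>0 {s..<t} = \<rho> s - \<rho> t"
  proof -
    have "{s..<t} = {0..<t} - {0..<s}" using st by auto
    then have "measure \<mu>\<^sub>0 {s..<t} = measure \<mu>\<^sub>0 {0..<t} - measure \<mu>\<^sub>0 {0..<s}"
      using st by (simp only:) (rule init.finite_measure_Diff, auto simp: sets_halfline_iff)
    then show ?thesis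
      using st by (simp add: measure_init_measure[OF integrable_f0 f0_nonneg] survival_eq)
  qed
  have "\<bar>A t - A s\<bar> = \<bar>LINT x|\<mu>\<^sub>0. shift_fun t \<phi> x - shift_fun s \<phi> x\<bar>"
    unfolding A_def using int by simp
  also have "\<dots> \<le> (LINT x|\<mu>\<^sub>0. \<bar>shift_fun t \<phi> x - shift_fun s \<phi> x\<bar>)"
    by (rule integral_abs_bound)
  also have "\<dots> \<le> (LINT x|\<mu>\<^sub>0. (t - s) + indicat_real {s..<t} x)"
  proof (rule integral_mono)
    show "integrable \<mu>\<^sub>0 (\<lambda>x. (t - s) + indicat_real {s..<t} x)"
      using win by (intro Bochner_Integration.integrable_add) (auto simp: init.emeasure_eq_measure)
    fix x
    show "\<bar>shift_fun t \<phi> x - shift_fun s \<phi> x\<bar> \<le> (t - s) + indicat_real {s..<t} x"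
      using lipschitz[of "x - t" "x - s"] bounded[of "x - s"] st by (auto simp: shift_fun_def)
  qed (use int in auto)
  also have "\<dots> = (t - s) + (\<rho> s - \<rho> t)"
    using win gap init.prob_space win_eq
    by (subst Bochner_Integration.integral_add) (auto simp: init.emeasure_eq_measure)
  finally have AA: "\<bar>A t - A s\<bar> \<le> (t - s) + (\<rho> s - \<rho> t)" .
  have "\<rho> t * A t - \<rho> s * A s = \<rho> t * (A t - A s) - (\<rho> s - \<rho> t) * A s"
    by (simp add: algebra_simps)
  also have "\<bar>\<dots>\<bar> \<le> \<rho> t * \<bar>A t - A s\<bar> + (\<rho> s - \<rho> t) * \<bar>A s\<bar>"
    using survival_nonneg[OF t] survival_antimono[OF st]
    by (intro order_trans[OF abs_triangle_ineq4]) (simp add: abs_mult)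
  also have "\<dots> \<le> 1 * ((t - s) + (\<rho> s - \<rho> t)) + (\<rho> s - \<rho> t) * 1"
    using survival_nonneg[OF t] survival_le_1[OF t] survival_antimono[OF st] AA A1
    by (intro add_mono mult_mono) auto
  finally show ?thesis
    using st t by (simp add: integral_limit_measure[OF \<phi>] A_def)
qed

end

section \<open>Uniform convergence in time\<close>

context initial_density
begin

text \<open>
  The mesh and the number of cells are chosen so that the mesh and the tail of the limit beyond the
  last cell are below \<open>e / 8\<close>; the tails at the finitely many rational grid points then converge,
  and the tail of the empirical measure beyond the last cell is controlled by that of the limit.
\<close>

lemma fixed_time_close:
  assumes path: "\<forall>\<^sub>F n in evens. removal_path (init_position f0 n ` {1..n}) (X n)"
    and tails: "\<And>u. u \<in> \<rat> \<Longrightarrow> 0 \<le> u \<Longrightarrow>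
      ((\<lambda>n. real (card (X n q \<inter> {u<..})) / real n) \<longlongrightarrow> \<rho> q * \<rho> (q + u)) evens"
    and q: "0 \<le> q" and e: "0 < e"
  shows "\<forall>\<^sub>F n in evens. \<forall>\<phi>. bl_test_function \<phi> \<longrightarrow>
    \<bar>integral\<^sup>L (empirical_measure n (X n q)) \<phi> - integral\<^sup>L (limit_measure q) \<phi>\<bar> \<le> e"
proof -
  obtain N where N: "1 / real (Suc N) < e / 8"
    using reals_Archimedean[of "e / 8"] e by (auto simp: inverse_eq_divide)
  define \<delta> where "\<delta> = 1 / real (Suc N)"
  have \<delta>: "0 < \<delta>" "\<delta> < e / 8" using N by (simp_all add: \<delta>_def)
  have "\<forall>\<^sub>F x in at_top. \<rho> x < e / 8"
    using survival_at_top by (rule order_tendstoD(2)) (use e in simp)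
  then obtain R where R: "\<And>x. R \<le> x \<Longrightarrow> \<rho> x < e / 8"
    by (auto simp: eventually_at_top_linorder)
  obtain m where m: "R / \<delta> \<le> real m" using real_arch_simple by blast
  have grid: "real i * \<delta> \<in> \<rat>" "0 \<le> real i * \<delta>" for i
    using \<delta> by (simp_all add: \<delta>_def)
  define a where "a = (\<lambda>n i. real (card (X n q \<inter> {real i * \<delta><..})) / real n)"
  define b where "b = (\<lambda>i. \<rho> q * \<rho> (q + real i * \<delta>))"
  have b_eq: "measure (limit_measure q) {real i * \<delta><..} = b i" for i
    unfolding b_def by (rule measure_limit_measure_tail[OF q grid(2)])
  have "R \<le> q + real m * \<delta>"
    using m \<delta> q by (simp add: pos_divide_le_eq)
  then have "\<rho> (q + real m * \<delta>) < e / 8" by (rule R)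
  moreover have "b m \<le> 1 * \<rho> (q + real m * \<delta>)"
    unfolding b_def using q grid(2)[of m] by (intro mult_right_mono survival_le_1 survival_nonneg) auto
  ultimately have bm: "b m < e / 8" by simp
  have "((\<lambda>n. \<Sum>i\<le>m. \<bar>a n i - b i\<bar>) \<longlongrightarrow> (\<Sum>i\<le>m. \<bar>b i - b i\<bar>)) evens"
    unfolding a_def b_def
    by (intro tendsto_sum tendsto_rabs tendsto_diff tendsto_const tails grid)
  then have "\<forall>\<^sub>F n in evens. (\<Sum>i\<le>m. \<bar>a n i - b i\<bar>) < e / 8"
    by (rule order_tendstoD(2)) (use e in simp)
  then show ?thesis using path
  proof eventually_elim
    case (elim n)
    note path = elim(2)
    define M where "M = empirical_measure n (X n q)"
    have fin: "finite (X n q)" "card (X n q) \<le> n"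
      using removal_path_card[OF path _ q] card_init_position[of n] by simp_all
    have sub: "X n q \<subseteq> {0<..}" by (rule removal_pathD(1)[OF path q])
    then have sub0: "X n q \<subseteq> {0..}" by auto
    have "X n q \<inter> {0} = {}" using sub by auto
    then have M: "finite_measure M" "sets M = sets halfline" "measure M {0} = 0"
      unfolding M_def
      by (simp_all add: finite_measure_empirical_measure measure_empirical_measure
          sets_empirical_measure fin(1) sub0)
    have tail: "measure M {real i * \<delta><..} = a n i" for i
    proof -
      have "{real i * \<delta><..} \<subseteq> {0..}"
        using grid(2)[of i] by (auto intro: order_trans less_imp_le)
      then show ?thesis
        unfolding M_def a_def by (intro measure_empirical_measure fin sub0) simp
    qed
    have "measure M {0..} = real (card (X n q \<inter> {0..})) / real n"
      unfolding M_def by (rule measure_empirical_measure[OF fin(1) sub0]) auto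
    then have total: "measure M {0..} \<le> 1"
      using fin(2) by (cases "n = 0") (simp_all add: Int_absorb2[OF sub0])
    have "\<bar>a n m - b m\<bar> \<le> (\<Sum>i\<le>m. \<bar>a n i - b i\<bar>)"
      by (rule member_le_sum) auto
    then have am: "a n m < e / 4" using elim(1) bm by linarith
    have "\<delta> * (measure M {0..} + measure (limit_measure q) {0..}) \<le> \<delta> * 2"
      using \<delta> total measure_limit_measure_total[OF q] by (intro mult_left_mono) linarith+
    then have mass: "\<delta> * (measure M {0..} + measure (limit_measure q) {0..}) \<le> e / 4"
      using \<delta> by linarith
    show ?case
    proof (intro allI impI)
      fix \<phi> assume "bl_test_function \<phi>"
      then interpret bl_test_function \<phi> .
      have "\<bar>integral\<^sup>L M \<phi> - integral\<^sup>L (limit_measure q) \<phi>\<bar>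
        \<le> \<delta> * (measure M {0..} + measure (limit_measure q) {0..}) + a n m + b m + 2 * (\<Sum>i\<le>m. \<bar>a n i - b i\<bar>)"
        using integral_close_of_tails_close[OF M finite_measure_limit_measure[OF q] sets_limit_measure
            measure_limit_measure_0[OF q] \<delta>(1), of m]
        unfolding tail b_eq .
      then show "\<bar>integral\<^sup>L (empirical_measure n (X n q)) \<phi> - integral\<^sup>L (limit_measure q) \<phi>\<bar> \<le> e"
        unfolding M_def[symmetric] using mass am bm elim(1) e by linarith
    qed
  qed
qed

text \<open>
  On a rational time grid with mesh at most \<open>d\<close>, on which \<open>\<rho>\<close> drops by at most \<open>d\<close>
  per step, the integrals are within \<open>d\<close> at the grid times by \<open>fixed_time_close\<close>. From
  the last grid time before \<open>t\<close> up to \<open>t\<close>, the limit integral moves by at most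
  \<open>3 * d\<close>. The empirical one moves by at most \<open>5 * d\<close>: the mass lost in a grid step is
  within \<open>2 * d\<close> of the loss of the limit, where the mass \<open>\<rho>\<^sup>2\<close> drops by at most
  \<open>2 * d\<close>.
\<close>

lemma uniform_in_time_close:
  assumes path: "\<forall>\<^sub>F n in evens. removal_path (init_position f0 n ` {1..n}) (X n)"
    and tails: "\<And>q u. q \<in> \<rat> \<Longrightarrow> 0 \<le> q \<Longrightarrow> u \<in> \<rat> \<Longrightarrow> 0 \<le> u \<Longrightarrow>
      ((\<lambda>n. real (card (X n q \<inter> {u<..})) / real n) \<longlongrightarrow> \<rho> q * \<rho> (q + u)) evens"
    and e: "0 < e"
  shows "\<forall>\<^sub>F n in evens. \<forall>t\<in>{0..T}. \<forall>\<phi>. bl_test_function \<phi> \<longrightarrow>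
    \<bar>integral\<^sup>L (empirical_measure n (X n t)) \<phi> - integral\<^sup>L (limit_measure t) \<phi>\<bar> \<le> e"
proof -
  define d where "d = e / 9"
  have d: "0 < d" using e by (simp add: d_def)
  have "uniformly_continuous_on {0..T + 1} \<rho>"
    by (intro compact_uniformly_continuous continuous_on_subset[OF continuous_on_survival]) auto
  then obtain r where r: "0 < r"
    "\<And>s t. s \<in> {0..T + 1} \<Longrightarrow> t \<in> {0..T + 1} \<Longrightarrow> dist t s < r \<Longrightarrow> dist (\<rho> t) (\<rho> s) < d"
    unfolding uniformly_continuous_on_def using d by blast
  obtain N where N: "1 / real (Suc N) < min r d"
    using reals_Archimedean[of "min r d"] r d by (auto simp: inverse_eq_divide)
  define \<delta> where "\<delta> = 1 / real (Suc N)"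
  have \<delta>: "0 < \<delta>" "\<delta> < r" "\<delta> < d" "\<delta> \<le> 1" using N by (simp_all add: \<delta>_def)
  obtain J where J: "T / \<delta> \<le> real J" using real_arch_simple by blast
  define s where "s = (\<lambda>j. real j * \<delta>)"
  have s: "s j \<in> \<rat>" "0 \<le> s j" for j using \<delta> by (simp_all add: s_def \<delta>_def)
  have s_Suc: "s (Suc j) = s j + \<delta>" for j by (simp add: s_def algebra_simps)
  have mass: "((\<lambda>n. real (card (X n (s j) \<inter> {0<..})) / real n) \<longlongrightarrow> \<rho> (s j) * \<rho> (s j)) evens" for j
    using tails[of "s j" 0] s by simp
  have "\<forall>\<^sub>F n in evens. \<forall>j\<in>{..Suc J}. \<bar>real (card (X n (s j) \<inter> {0<..})) / real n - \<rho> (s j) * \<rho> (s j)\<bar> < d"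
    using tendstoD[OF mass d] by (intro eventually_ball_finite) (auto simp: dist_real_def)
  moreover have "\<forall>\<^sub>F n in evens. \<forall>j\<in>{..Suc J}. \<forall>\<phi>. bl_test_function \<phi> \<longrightarrow>
    \<bar>integral\<^sup>L (empirical_measure n (X n (s j))) \<phi> - integral\<^sup>L (limit_measure (s j)) \<phi>\<bar> \<le> d"
    using s d by (intro eventually_ball_finite ballI fixed_time_close path tails) auto
  moreover have "\<forall>\<^sub>F n in evens. 2 \<le> n" by (rule eventually_evensI)
  ultimately show ?thesis using path
  proof eventually_elim
    case (elim n)
    note mass_close = elim(1) and grid_close = elim(2) and path = elim(4)
    have n: "0 < real n" using elim(3) by simp
    let ?C = "init_position f0 n ` {1..n}"
    have empirical: "integral\<^sup>L (empirical_measure n (X n t)) \<phi> = (\<Sum>x\<in>X n t. \<phi> x) / real n"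
      if "bl_test_function \<phi>" "0 \<le> t" for \<phi> t
    proof -
      interpret bl_test_function \<phi> by fact
      show ?thesis
        using removal_path_card(1)[OF path _ that(2)] removal_pathD(1)[OF path that(2)]
        by (intro integral_empirical_measure measurable) auto
    qed
    show ?case
    proof (intro ballI allI impI)
      fix t \<phi> assume t: "t \<in> {0..T}" and \<phi>: "bl_test_function \<phi>"
      interpret bl_test_function \<phi> by fact
      define j where "j = nat \<lfloor>t / \<delta>\<rfloor>"
      have "0 \<le> t / \<delta>" using t \<delta> by simp
      then have "real j \<le> t / \<delta>" "t / \<delta> < real (Suc j)"
        unfolding j_def by linarith+
      then have j: "s j \<le> t" "t \<le> s (Suc j)"
        using \<delta> by (simp_all add: s_def pos_le_divide_eq pos_divide_less_eq less_imp_le)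
      have "t / \<delta> \<le> T / \<delta>" using t \<delta> by (intro divide_right_mono) auto
      then have "real j \<le> real J" using \<open>real j \<le> t / \<delta>\<close> J by linarith
      then have jJ: "j \<in> {..Suc J}" "Suc j \<in> {..Suc J}" by simp_all
      have "dist (\<rho> (s (Suc j))) (\<rho> (s j)) < d"
        using s j t \<delta> by (intro r(2)) (auto simp: s_Suc dist_real_def)
      then have drop: "\<rho> (s j) - \<rho> (s (Suc j)) < d" by (simp add: dist_real_def)
      have anti: "\<rho> (s (Suc j)) \<le> \<rho> t" "\<rho> t \<le> \<rho> (s j)"
        using j t s by (auto intro: survival_antimono)
      have inc: "\<bar>integral\<^sup>L (limit_measure t) \<phi> - integral\<^sup>L (limit_measure (s j)) \<phi>\<bar>
          \<le> (t - s j) + 2 * (\<rho> (s j) - \<rho> t)"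
        by (rule integral_limit_measure_increment[OF \<phi> s(2) j(1)])
      have count: "X n r \<inter> {0<..} = X n r" if "0 \<le> r" for r
        using removal_pathD(1)[OF path that] by auto
      define c where "c = (\<lambda>i. real (card (X n (s i))) / real n)"
      have c: "\<bar>c i - \<rho> (s i) * \<rho> (s i)\<bar> < d" if "i \<in> {..Suc J}" for i
        using bspec[OF mass_close that] unfolding c_def count[OF s(2)] .
      have "\<rho> (s j) * \<rho> (s j) - \<rho> (s (Suc j)) * \<rho> (s (Suc j))
          = (\<rho> (s j) - \<rho> (s (Suc j))) * (\<rho> (s j) + \<rho> (s (Suc j)))"
        by (simp add: algebra_simps)
      also have "\<dots> \<le> (\<rho> (s j) - \<rho> (s (Suc j))) * 2"
        using anti survival_le_1[OF s(2)[of j]] survival_le_1[OF s(2)[of "Suc j"]]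
        by (intro mult_left_mono) linarith+
      also have "\<dots> \<le> d * 2"
        using drop by simp
      finally have loss: "c j - c (Suc j) \<le> 4 * d"
        using c[OF jJ(1)] c[OF jJ(2)] by linarith
      have "\<bar>integral\<^sup>L (empirical_measure n (X n t)) \<phi> - integral\<^sup>L (empirical_measure n (X n (s j))) \<phi>\<bar>
          = \<bar>(\<Sum>x\<in>X n t. \<phi> x) - (\<Sum>x\<in>X n (s j). \<phi> x)\<bar> / real n"
        using t s n by (simp add: empirical[OF \<phi>] diff_divide_distrib[symmetric] abs_divide)
      also have "\<dots> \<le> ((t - s j) * real (card ?C)
          + (real (card (X n (s j))) - real (card (X n (s (Suc j)))))) / real n"
        by (intro divide_right_mono sum_survivors_increment[OF path _ s(2) j]) auto
      also have "\<dots> = (t - s j) + (c j - c (Suc j))"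
        unfolding card_init_position c_def using n by (simp add: add_divide_distrib diff_divide_distrib)
      finally have emp: "\<bar>integral\<^sup>L (empirical_measure n (X n t)) \<phi>
          - integral\<^sup>L (empirical_measure n (X n (s j))) \<phi>\<bar> \<le> (t - s j) + (c j - c (Suc j))" .
      have grid: "\<bar>integral\<^sup>L (empirical_measure n (X n (s j))) \<phi> - integral\<^sup>L (limit_measure (s j)) \<phi>\<bar> \<le> d"
        using grid_close jJ(1) \<phi> by blast
      have step: "t - s j \<le> d" using j \<delta> by (simp add: s_Suc)
      have loss_t: "\<rho> (s j) - \<rho> t \<le> d" using anti drop by linarith
      have "(t - s j) + (c j - c (Suc j)) \<le> 5 * d" using step loss by linarith
      note empirical_step = order_trans[OF emp this]
      have "(t - s j) + 2 * (\<rho> (s j) - \<rho> t) \<le> 3 * d" using step loss_t unfolding right_diff_distrib by linarith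
      note limit_step = order_trans[OF inc this]
      have triangle: "\<bar>w - z\<bar> \<le> 9 * d" if "\<bar>w - x\<bar> \<le> 5 * d" "\<bar>x - y\<bar> \<le> d" "\<bar>z - y\<bar> \<le> 3 * d" for w x y z
        using that by linarith
      from triangle[OF empirical_step grid limit_step]
      have "\<bar>integral\<^sup>L (empirical_measure n (X n t)) \<phi> - integral\<^sup>L (limit_measure t) \<phi>\<bar> \<le> 9 * d" .
      then show "\<bar>integral\<^sup>L (empirical_measure n (X n t)) \<phi> - integral\<^sup>L (limit_measure t) \<phi>\<bar> \<le> e"
        by (simp add: d_def)
    qed
  qed
qed

lemma paths_converge:
  assumes path: "\<forall>\<^sub>F n in evens. removal_path (init_position f0 n ` {1..n}) (X n)"
    and tails: "\<And>q u. q \<in> \<rat> \<Longrightarrow> 0 \<le> q \<Longrightarrow> u \<in> \<rat> \<Longrightarrow> 0 \<le> u \<Longrightarrow>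
      ((\<lambda>n. real (card (X n q \<inter> {u<..})) / real n) \<longlongrightarrow> \<rho> q * \<rho> (q + u)) evens"
    and T: "0 < T"
  shows "((\<lambda>n. SUP t\<in>{0..T}. bl_dist (empirical_measure n (X n t)) (limit_measure t)) \<longlongrightarrow> 0) evens"
proof (rule order_tendstoI)
  fix a :: ereal assume a: "a < 0"
  have "0 \<le> (SUP t\<in>{0..T}. bl_dist (empirical_measure n (X n t)) (limit_measure t))" for n
    using T by (intro SUP_upper2[of 0] bl_dist_nonneg) auto
  then show "\<forall>\<^sub>F n in evens. a < (SUP t\<in>{0..T}. bl_dist (empirical_measure n (X n t)) (limit_measure t))"
    using a by (intro always_eventually allI) (rule less_le_trans)
next
  fix a :: ereal assume "0 < a"
  then obtain e where e: "0 < e" "ereal e < a"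
    using ereal_dense2[of 0 a] by auto
  have "\<forall>\<^sub>F n in evens. \<forall>t\<in>{0..T}. \<forall>\<phi>. bl_test_function \<phi> \<longrightarrow>
      \<bar>integral\<^sup>L (empirical_measure n (X n t)) \<phi> - integral\<^sup>L (limit_measure t) \<phi>\<bar> \<le> e"
    by (intro uniform_in_time_close path tails e(1))
  then show "\<forall>\<^sub>F n in evens. (SUP t\<in>{0..T}. bl_dist (empirical_measure n (X n t)) (limit_measure t)) < a"
  proof eventually_elim
    case (elim n)
    have "(SUP t\<in>{0..T}. bl_dist (empirical_measure n (X n t)) (limit_measure t)) \<le> ereal e"
    proof (rule SUP_least)
      fix t assume t: "t \<in> {0..T}"
      show "bl_dist (empirical_measure n (X n t)) (limit_measure t) \<le> ereal e"
        unfolding bl_dist_def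
      proof (rule SUP_least)
        fix \<phi> assume "\<phi> \<in> {\<phi>. bl_norm \<phi> \<le> 1}"
        then have "bl_test_function \<phi>" by (simp add: bl_test_function_if_bl_norm_le_1)
        then have "\<bar>integral\<^sup>L (empirical_measure n (X n t)) \<phi> - integral\<^sup>L (limit_measure t) \<phi>\<bar> \<le> e"
          using elim t by blast
        then show "ereal (integral\<^sup>L (empirical_measure n (X n t)) \<phi> - integral\<^sup>L (limit_measure t) \<phi>) \<le> ereal e"
          by simp
      qed
    qed
    then show ?case using e(2) by (rule le_less_trans)
  qed
qed

end

theorem corollary1:
  fixes f0 :: "real \<Rightarrow> real" and T :: real
  assumes "set_integrable lebesgue {0<..} f0"
    and "AE y in lebesgue. 0 < y \<longrightarrow> 0 \<le> f0 y"
    and "(LINT y:{0<..}|lebesgue. f0 y) = 1"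
    and "0 < T"
  shows "AE \<omega> in joint_law f0.
    ((\<lambda>n. SUP t\<in>{0..T}. bl_dist (empirical_measure n (\<omega> n t))
        (scale_measure (ennreal (survival f0 t)) (shift_measure t (init_measure f0)))) \<longlongrightarrow> 0)
      (inf sequentially (principal {n. even n}))"
proof -
  interpret initial_density f0
    by unfold_locales (fact assms)+
  define Q where "Q = {(q, u). q \<in> \<rat> \<and> (0::real) \<le> q \<and> u \<in> \<rat> \<and> (0::real) \<le> u}"
  have "countable Q"
    by (rule countable_subset[of _ "\<rat> \<times> \<rat>"]) (auto simp: Q_def countable_rat)
  moreover have "AE \<omega> in joint_law f0.
      ((\<lambda>n. real (card (\<omega> n (fst z) \<inter> {snd z<..})) / real n) \<longlongrightarrow> \<rho> (fst z) * \<rho> (fst z + snd z)) evens"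
    if "z \<in> Q" for z
    using that by (intro AE_survivor_frequency) (auto simp: Q_def)
  ultimately have "AE \<omega> in joint_law f0. \<forall>z\<in>Q.
      ((\<lambda>n. real (card (\<omega> n (fst z) \<inter> {snd z<..})) / real n) \<longlongrightarrow> \<rho> (fst z) * \<rho> (fst z + snd z)) evens"
    by (simp add: AE_ball_countable)
  then show ?thesis
    using AE_removal_path
  proof eventually_elim
    case (elim \<omega>)
    show ?case
    proof (rule paths_converge)
      show "\<forall>\<^sub>F n in evens. removal_path (init_position f0 n ` {1..n}) (\<omega> n)"
        using elim(2) by (intro eventually_evensI) blast
      show "((\<lambda>n. real (card (\<omega> n q \<inter> {u<..})) / real n) \<longlongrightarrow> \<rho> q * \<rho> (q + u)) evens"
        if "q \<in> \<rat>" "0 \<le> q" "u \<in> \<rat>" "0 \<le> u" for q u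
        using elim(1)[rule_format, of "(q, u)"] that by (simp add: Q_def)
    qed (fact assms(4))
  qed
qed

end
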